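(* Let $n\ge3$. If $\phi\in\mathcal{B}$, then the function $\log^+|\phi|:\mathcal{A}\to\mathbb{R}_{\ge0}$, $\gamma\mapsto\max\{0,\log|\phi(\gamma)|\}$, has a lower Fibonacci bound on $\mathcal{A}$.
   Context: Let $[n]=\{1,\dots,n\}$ and let $\Delta$ be the $n$-regular tree with a distinguished root vertex $v_0$ whose edges are labeled by elements of $[n]$ so that the $n$ edges at each vertex carry distinct labels. For a vertex $v$ and $I\subset[n]$, $[v;I]$ is the connected component containing $v$ of the forest obtained from $\Delta$ by deleting all (open) edges whose label is not in $I$. Write $\hat{i}=[n]\setminus\{i\}$. Let $\mathcal{X}$ be the set of all subtrees $[v;\hat{i}]$ and let $\mathcal{A}$ be the set of all $[v;\{i,j\}]$, $i\ne j$ (alternating geodesics). A Hurwitz map is a function $\phi:\mathcal{X}\to\mathbb{C}$ such that for every edge labeled $i$ with end vertices $v,v'$, $\phi([v;\hat{i}])+\phi([v';\hat{i}])=\prod_{j\ne i}\phi([v;\hat{j}])$. It is extended to $\mathcal{A}$ by $\phi([v;\{i,j\}])=\prod_{k\ne i,j}\phi([v;\hat{k}])$. $\mathcal{B}$ is the set of Hurwitz maps $\phi$ satisfying the Bowditch conditions: (B1) $\phi(\gamma)\notin[-2,2]$ for all $\gamma\in\mathcal{A}$; (B2) $\mathcal{A}_\phi(K)=\{\gamma\in\mathcal{A}:|\phi(\gamma)|\le K\}$ is finite (possibly empty) for some $K>2$. Fibonacci function $F:\mathcal{A}\to\mathbb{N}$ (relative to $v_0$): $F(\gamma)=1$ if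 $v_0\in\gamma$; otherwise let $v^*$ be the vertex of $\gamma$ closest to $v_0$, write $\gamma=[v^*;\{i,j\}]$, let $k$ be the label of the edge at $v^*$ lying on the geodesic from $v^*$ to $v_0$ (so $k\ne i,j$), and set $F(\gamma)=F([v^*;\{i,k\}])+F([v^*;\{j,k\}])$ (a recursion on the distance from $\gamma$ to $v_0$). A function $f:\mathcal{A}\to\mathbb{R}_{\ge0}$ has a lower Fibonacci bound on $\mathcal{A}$ if there is a constant $K>0$ with $f(\gamma)\ge\frac1K F(\gamma)$ for all but finitely many $\gamma\in\mathcal{A}$. *)

theory Defs
  imports "HOL-Analysis.Analysis"
begin

record 'v labelled_graph =
  verts :: "'v set"
  edges :: "'v set set"
  label :: "'v set \<Rightarrow> nat"

definition simple_graph :: "'v labelled_graph \<Rightarrow> bool" where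
  "simple_graph \<Delta> \<longleftrightarrow>
     (\<forall>e\<in>edges \<Delta>. \<exists>u v. u \<in> verts \<Delta> \<and> v \<in> verts \<Delta> \<and> u \<noteq> v \<and> e = {u, v})"

definition walk :: "'v labelled_graph \<Rightarrow> 'v list \<Rightarrow> 'v \<Rightarrow> 'v \<Rightarrow> bool" where
  "walk \<Delta> p u v \<longleftrightarrow> p \<noteq> [] \<and> set p \<subseteq> verts \<Delta> \<and> successively (\<lambda>x y. {x, y} \<in> edges \<Delta>) p \<and>
     hd p = u \<and> last p = v"

definition connected_graph :: "'v labelled_graph \<Rightarrow> bool" where
  "connected_graph \<Delta> \<longleftrightarrow> verts \<Delta> \<noteq> {} \<and> (\<forall>u\<in>verts \<Delta>. \<forall>v\<in>verts \<Delta>. \<exists>p. walk \<Delta> p u v)"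

text \<open>A cycle is the list of its pairwise distinct vertices; the edge closing it up joins the
  last vertex to the first one.\<close>

definition is_cycle :: "'v labelled_graph \<Rightarrow> 'v list \<Rightarrow> bool" where
  "is_cycle \<Delta> p \<longleftrightarrow> length p \<ge> 3 \<and> distinct p \<and> walk \<Delta> p (hd p) (last p) \<and>
     {last p, hd p} \<in> edges \<Delta>"

definition is_tree :: "'v labelled_graph \<Rightarrow> bool" where
  "is_tree \<Delta> \<longleftrightarrow> simple_graph \<Delta> \<and> connected_graph \<Delta> \<and> (\<nexists>p. is_cycle \<Delta> p)"

text \<open>The bijection at each vertex expresses both \<open>n\<close>-regularity and that the \<open>n\<close> edges at the
  vertex carry distinct labels in \<open>{1..n}\<close>.\<close>

definition labelled_regular_tree :: "nat \<Rightarrow> 'v labelled_graph \<Rightarrow> bool" where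
  "labelled_regular_tree n \<Delta> \<longleftrightarrow> is_tree \<Delta> \<and>
     (\<forall>v\<in>verts \<Delta>. bij_betw (label \<Delta>) {e \<in> edges \<Delta>. v \<in> e} {1..n})"

text \<open>The component \<open>[v;I]\<close>. Since \<open>\<Delta>\<close> is a tree, a subtree is determined by its vertex set
  (its edges are all the edges of \<open>\<Delta>\<close> between these vertices), so subtrees are represented
  by their vertex sets.\<close>

definition component :: "'v labelled_graph \<Rightarrow> 'v \<Rightarrow> nat set \<Rightarrow> 'v set" where
  "component \<Delta> v I = {w. (v, w) \<in> {(x, y). {x, y} \<in> edges \<Delta> \<and> label \<Delta> {x, y} \<in> I}\<^sup>*}"

definition hat :: "nat \<Rightarrow> nat \<Rightarrow> nat set" where
  "hat n i = {1..n} - {i}"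

definition hat_subtrees :: "nat \<Rightarrow> 'v labelled_graph \<Rightarrow> 'v set set" where
  "hat_subtrees n \<Delta> = {component \<Delta> v (hat n i) |v i. v \<in> verts \<Delta> \<and> i \<in> {1..n}}"

definition alt_geodesics :: "nat \<Rightarrow> 'v labelled_graph \<Rightarrow> 'v set set" where
  "alt_geodesics n \<Delta> =
     {component \<Delta> v {i, j} |v i j. v \<in> verts \<Delta> \<and> i \<in> {1..n} \<and> j \<in> {1..n} \<and> i \<noteq> j}"

text \<open>A map on \<open>\<X> = hat_subtrees n \<Delta>\<close> is a function on all vertex sets of which only the values
  on \<open>\<X>\<close> are used.\<close>

definition hurwitz_map :: "nat \<Rightarrow> 'v labelled_graph \<Rightarrow> ('v set \<Rightarrow> complex) \<Rightarrow> bool" where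
  "hurwitz_map n \<Delta> \<phi> \<longleftrightarrow>
     (\<forall>v v' i. {v, v'} \<in> edges \<Delta> \<and> label \<Delta> {v, v'} = i \<longrightarrow>
        \<phi> (component \<Delta> v (hat n i)) + \<phi> (component \<Delta> v' (hat n i)) =
        (\<Prod>j\<in>{1..n} - {i}. \<phi> (component \<Delta> v (hat n j))))"

text \<open>The extension of \<open>\<phi>\<close> to alternating geodesics. The value does not depend on how \<open>\<gamma>\<close> is
  written as \<open>[v;{i,j}]\<close>: \<open>\<gamma>\<close> determines \<open>{i,j}\<close>, and for \<open>k \<noteq> i, j\<close> the subtree
  \<open>[v;hat n k]\<close> is the same for all vertices \<open>v\<close> of \<open>\<gamma>\<close>.\<close>

definition hurwitz_ext ::
  "nat \<Rightarrow> 'v labelled_graph \<Rightarrow> ('v set \<Rightarrow> complex) \<Rightarrow> 'v set \<Rightarrow> complex" where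
  "hurwitz_ext n \<Delta> \<phi> \<gamma> =
     (THE z. \<exists>v i j. v \<in> verts \<Delta> \<and> i \<in> {1..n} \<and> j \<in> {1..n} \<and> i \<noteq> j \<and>
        \<gamma> = component \<Delta> v {i, j} \<and>
        z = (\<Prod>k\<in>{1..n} - {i, j}. \<phi> (component \<Delta> v (hat n k))))"

definition bowditch_B1 :: "nat \<Rightarrow> 'v labelled_graph \<Rightarrow> ('v set \<Rightarrow> complex) \<Rightarrow> bool" where
  "bowditch_B1 n \<Delta> \<phi> \<longleftrightarrow>
     (\<forall>\<gamma>\<in>alt_geodesics n \<Delta>. hurwitz_ext n \<Delta> \<phi> \<gamma> \<notin> complex_of_real ` {-2..2})"

definition bowditch_B2 :: "nat \<Rightarrow> 'v labelled_graph \<Rightarrow> ('v set \<Rightarrow> complex) \<Rightarrow> bool" where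
  "bowditch_B2 n \<Delta> \<phi> \<longleftrightarrow>
     (\<exists>K::real. K > 2 \<and> finite {\<gamma> \<in> alt_geodesics n \<Delta>. norm (hurwitz_ext n \<Delta> \<phi> \<gamma>) \<le> K})"

definition bowditch_maps :: "nat \<Rightarrow> 'v labelled_graph \<Rightarrow> ('v set \<Rightarrow> complex) set" where
  "bowditch_maps n \<Delta> = {\<phi>. hurwitz_map n \<Delta> \<phi> \<and> bowditch_B1 n \<Delta> \<phi> \<and> bowditch_B2 n \<Delta> \<phi>}"

text \<open>The length of a walk is its number of edges, one less than its number of vertices.\<close>

definition gdist :: "'v labelled_graph \<Rightarrow> 'v \<Rightarrow> 'v \<Rightarrow> nat" where
  "gdist \<Delta> u v = (LEAST d. \<exists>p. walk \<Delta> p u v \<and> length p = Suc d)"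

definition geodesic :: "'v labelled_graph \<Rightarrow> 'v list \<Rightarrow> 'v \<Rightarrow> 'v \<Rightarrow> bool" where
  "geodesic \<Delta> p u v \<longleftrightarrow> walk \<Delta> p u v \<and> length p = Suc (gdist \<Delta> u v)"

definition closest_vertex :: "'v labelled_graph \<Rightarrow> 'v \<Rightarrow> 'v set \<Rightarrow> 'v \<Rightarrow> bool" where
  "closest_vertex \<Delta> v0 \<gamma> v \<longleftrightarrow> v \<in> \<gamma> \<and> (\<forall>w\<in>\<gamma>. gdist \<Delta> v v0 \<le> gdist \<Delta> w v0)"

text \<open>The recursion for the Fibonacci function as the inductive definition of its graph:
  \<open>fib_graph n \<Delta> v0 \<gamma> m\<close> means \<open>F(\<gamma>) = m\<close>. In the recursive rule, \<open>k\<close> is the label of the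
  first edge of the geodesic from \<open>v\<close> to \<open>v0\<close>; that \<open>k \<noteq> i, j\<close> is automatic, as \<open>v\<close> is the vertex
  of \<open>\<gamma>\<close> closest to \<open>v0\<close>. The component of \<open>{i, k}\<close> at \<open>v\<close> contains the next vertex of that
  geodesic, so it is nearer to \<open>v0\<close> and the recursion ends: each alternating geodesic is related
  to exactly one \<open>m\<close>.\<close>

inductive fib_graph :: "nat \<Rightarrow> 'v labelled_graph \<Rightarrow> 'v \<Rightarrow> 'v set \<Rightarrow> nat \<Rightarrow> bool"
  for n \<Delta> v0 where
  base: "\<lbrakk>\<gamma> \<in> alt_geodesics n \<Delta>; v0 \<in> \<gamma>\<rbrakk> \<Longrightarrow> fib_graph n \<Delta> v0 \<gamma> 1"
| step: "\<lbrakk>\<gamma> \<in> alt_geodesics n \<Delta>; v0 \<notin> \<gamma>; closest_vertex \<Delta> v0 \<gamma> v;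
     i \<in> {1..n}; j \<in> {1..n}; i \<noteq> j; \<gamma> = component \<Delta> v {i, j};
     geodesic \<Delta> p v v0; k = label \<Delta> {p ! 0, p ! 1};
     fib_graph n \<Delta> v0 (component \<Delta> v {i, k}) a;
     fib_graph n \<Delta> v0 (component \<Delta> v {j, k}) b\<rbrakk> \<Longrightarrow> fib_graph n \<Delta> v0 \<gamma> (a + b)"

definition fibonacci :: "nat \<Rightarrow> 'v labelled_graph \<Rightarrow> 'v \<Rightarrow> 'v set \<Rightarrow> nat" where
  "fibonacci n \<Delta> v0 \<gamma> = (THE m. fib_graph n \<Delta> v0 \<gamma> m)"

definition lower_fibonacci_bound ::
  "nat \<Rightarrow> 'v labelled_graph \<Rightarrow> 'v \<Rightarrow> ('v set \<Rightarrow> real) \<Rightarrow> bool" where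
  "lower_fibonacci_bound n \<Delta> v0 f \<longleftrightarrow>
     (\<exists>K::real. K > 0 \<and>
        finite {\<gamma> \<in> alt_geodesics n \<Delta>. \<not> f \<gamma> \<ge> 1 / K * real (fibonacci n \<Delta> v0 \<gamma>)})"

text \<open>The library value \<open>ln 0 = 0\<close> makes \<open>log_plus 0 = 0\<close>, as the convention \<open>log 0 = -\<infinity>\<close> does.\<close>

definition log_plus :: "real \<Rightarrow> real" where
  "log_plus x = max 0 (ln x)"

end

theory Submission
  imports Defs
begin

text \<open>Vertices are coded by reduced words in the labels, so that \<open>[v;I]\<close> is obtained by stripping
  letters of \<open>I\<close> from the front of a word, and a Hurwitz map becomes a family of values \<open>a k w\<close>.
  Along an alternating geodesic \<open>\<gamma>\<close> the two changing values satisfy the recurrence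
  \<open>b (m + 2) = \<phi>(\<gamma>) * b (m + 1) - b m\<close>; by (B1) and (B2) they grow exponentially in both
  directions, whereas \<open>F\<close> grows linearly on the geodesics crossing \<open>\<gamma>\<close>. Away from the finitely
  many words with an edge directed away from the root, the edge relation gives
  \<open>|\<phi>[v;{i,j}]| / 2 \<ge> (|\<phi>[v;{i,k}]| / 2) * (|\<phi>[v;{j,k}]| / 2)\<close>, where \<open>k\<close> is the label towards the
  root. So \<open>ln (|\<phi>| / 2)\<close> is superadditive where \<open>F\<close> is additive, and the bound propagates by
  induction on the distance to the root. The exceptional geodesics, with \<open>|\<phi>| \<le> K\<close>, are where this
  step fails; there the exponential growth takes over.\<close>

lemma dropWhile_idem: "dropWhile Q (dropWhile Q x) = dropWhile Q x"
  by (induction x) auto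

section \<open>Labelled regular trees and travelling along words of labels\<close>

locale rooted_labelled_tree =
  fixes n :: nat and \<Delta> :: "'v labelled_graph" and v0 :: 'v
  assumes regular: "labelled_regular_tree n \<Delta>"
    and root: "v0 \<in> verts \<Delta>"
begin

lemma tree: "simple_graph \<Delta>" "connected_graph \<Delta>" "\<nexists>p. is_cycle \<Delta> p"
  using regular by (auto simp: labelled_regular_tree_def is_tree_def)

lemma label_bij: "v \<in> verts \<Delta> \<Longrightarrow> bij_betw (label \<Delta>) {e \<in> edges \<Delta>. v \<in> e} {1..n}"
  using regular by (auto simp: labelled_regular_tree_def)

lemma edge_verts:
  assumes "{x, y} \<in> edges \<Delta>"
  shows "x \<in> verts \<Delta>" "y \<in> verts \<Delta>" "x \<noteq> y"
  using tree(1) assms unfolding simple_graph_def by (metis doubleton_eq_iff)+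

lemma edge_label:
  assumes "{x, y} \<in> edges \<Delta>"
  shows "label \<Delta> {x, y} \<in> {1..n}"
  using label_bij[OF edge_verts(1)[OF assms]] assms unfolding bij_betw_def by blast

lemma edge_unique:
  assumes "{v, x} \<in> edges \<Delta>" "{v, y} \<in> edges \<Delta>" "label \<Delta> {v, x} = label \<Delta> {v, y}"
  shows "x = y"
proof -
  have "inj_on (label \<Delta>) {e \<in> edges \<Delta>. v \<in> e}"
    using label_bij[OF edge_verts(1)[OF assms(1)]] by (simp add: bij_betw_def)
  then have "{v, x} = {v, y}"
    using assms by (auto dest: inj_onD)
  then show ?thesis by (metis doubleton_eq_iff)
qed

lemma edge_exists:
  assumes "v \<in> verts \<Delta>" "k \<in> {1..n}"
  shows "\<exists>x. {v, x} \<in> edges \<Delta> \<and> label \<Delta> {v, x} = k"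
proof -
  have "k \<in> label \<Delta> ` {e \<in> edges \<Delta>. v \<in> e}"
    using label_bij[OF assms(1)] assms(2) by (simp add: bij_betw_def)
  then obtain e where e: "e \<in> edges \<Delta>" "v \<in> e" "label \<Delta> e = k" by auto
  then obtain x y where "e = {x, y}"
    using tree(1) unfolding simple_graph_def by blast
  with e have "e = {v, x} \<or> e = {v, y}" by auto
  with e show ?thesis by auto
qed

definition nbr :: "'v \<Rightarrow> nat \<Rightarrow> 'v" where
  "nbr v k = (SOME x. {v, x} \<in> edges \<Delta> \<and> label \<Delta> {v, x} = k)"

lemma nbr_edge:
  assumes "v \<in> verts \<Delta>" "k \<in> {1..n}"
  shows "{v, nbr v k} \<in> edges \<Delta>" "label \<Delta> {v, nbr v k} = k"
  using someI_ex[OF edge_exists[OF assms]] by (auto simp: nbr_def)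

lemma nbr_verts: "v \<in> verts \<Delta> \<Longrightarrow> k \<in> {1..n} \<Longrightarrow> nbr v k \<in> verts \<Delta>"
  using nbr_edge(1) edge_verts(2) by blast

lemma nbr_eqI:
  assumes "{v, x} \<in> edges \<Delta>" "label \<Delta> {v, x} = k"
  shows "nbr v k = x"
  using assms nbr_edge edge_verts edge_label edge_unique by metis

lemma nbr_nbr: "v \<in> verts \<Delta> \<Longrightarrow> k \<in> {1..n} \<Longrightarrow> nbr (nbr v k) k = v"
  by (rule nbr_eqI) (use nbr_edge in \<open>auto simp: insert_commute\<close>)

lemma nbr_inj:
  assumes "v \<in> verts \<Delta>" "k \<in> {1..n}" "l \<in> {1..n}" "nbr v k = nbr v l"
  shows "k = l"
  using assms nbr_edge(2) by metis

text \<open>\<open>foldr\<close> uses the last letter first, so prepending a letter adds an edge at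
  the far end. Read from its head, a word thus leads from \<open>travel w v\<close> back to
  \<open>v\<close>.\<close>

definition travel :: "nat list \<Rightarrow> 'v \<Rightarrow> 'v" where
  "travel w v = foldr (\<lambda>k x. nbr x k) w v"

lemma travel_simps [simp]:
  "travel [] v = v" "travel (k # w) v = nbr (travel w v) k"
  "travel (u @ w) v = travel u (travel w v)"
  by (simp_all add: travel_def)

lemma travel_verts: "v \<in> verts \<Delta> \<Longrightarrow> set w \<subseteq> {1..n} \<Longrightarrow> travel w v \<in> verts \<Delta>"
  by (induction w) (auto simp: nbr_verts)

text \<open>A word lists the labels on the geodesic from a vertex to the root; its head is the label of
  the edge at the vertex.\<close>

definition word :: "nat list \<Rightarrow> bool" where
  "word w \<longleftrightarrow> set w \<subseteq> {1..n} \<and> distinct_adj w"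

lemma word_Nil [simp]: "word []"
  by (simp add: word_def)

lemma word_Cons: "word (k # w) \<longleftrightarrow> k \<in> {1..n} \<and> word w \<and> (w \<noteq> [] \<longrightarrow> hd w \<noteq> k)"
  by (cases w) (auto simp: word_def)

lemma word_append:
  "word (u @ w) \<longleftrightarrow> word u \<and> word w \<and> (u \<noteq> [] \<and> w \<noteq> [] \<longrightarrow> last u \<noteq> hd w)"
  by (auto simp: word_def distinct_adj_append_iff)

lemma word_rev: "word (rev w) \<longleftrightarrow> word w"
  by (simp add: word_def)

lemma word_tl: "word w \<Longrightarrow> word (tl w)"
  by (cases w) (auto simp: word_Cons)

lemma word_dropWhile: "word w \<Longrightarrow> word (dropWhile Q w)"
  by (induction w) (auto simp: word_Cons)

text \<open>A shortest closed reduced word would trace out a cycle.\<close>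

lemma travel_neq:
  assumes "word u" "u \<noteq> []" "v \<in> verts \<Delta>"
  shows "travel u v \<noteq> v"
  using assms
proof (induction "length u" arbitrary: u v rule: less_induct)
  case less
  show ?case
  proof
    assume closed: "travel u v = v"
    define m where "m = length u"
    have u: "set u \<subseteq> {1..n}" using less.prems by (simp add: word_def)
    \<comment> \<open>The vertices of the closed walk, numbered from its end: \<open>x 0\<close> is
      the final vertex and \<open>x m\<close> the initial one.\<close>
    define x where "x i = travel (drop i u) v" for i
    have xv: "x i \<in> verts \<Delta>" for i
      unfolding x_def using u less.prems(3) by (intro travel_verts) (auto dest: in_set_dropD)
    have xm: "x m = v" and x0: "x 0 = v" using closed by (simp_all add: x_def m_def)
    have step: "x i = nbr (x (Suc i)) (u ! i)" if "i < m" for i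
      using that by (simp add: x_def m_def flip: Cons_nth_drop_Suc)
    have edge: "{x i, x (Suc i)} \<in> edges \<Delta>" if "i < m" for i
      using nbr_edge(1)[OF xv, of "u ! i" "Suc i"] step[OF that] that u
      by (auto simp: m_def insert_commute subset_iff)
    \<comment> \<open>A coincidence \<open>x i = x j\<close> would close up the subword between
      them. That subword is reduced and shorter than \<open>u\<close>, so the induction hypothesis,
      applied at the base vertex \<open>x j\<close>, forbids it.\<close>
    have neq: "x i \<noteq> x j" if "i < j" "j \<le> m" "j - i < m" for i j
    proof -
      let ?s = "take (j - i) (drop i u)"
      have "drop i u = ?s @ drop j u"
        using that by (metis append_take_drop_id drop_drop le_add_diff_inverse2 less_imp_le)
      then have *: "x i = travel ?s (x j)" by (metis travel_simps(3) x_def)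
      have w: "word ?s"
        using less.prems(1) by (metis append_take_drop_id word_append)
      have "length ?s < length u" "?s \<noteq> []" using that by (auto simp: m_def)
      from less.hyps[OF this(1) w this(2) xv] * show ?thesis by metis
    qed
    have "m \<noteq> 0" using less.prems by (simp add: m_def)
    moreover have "m \<noteq> 1"
    proof
      assume "m = 1"
      then show False using edge[of 0] xm x0 edge_verts(3) by fastforce
    qed
    moreover have "m \<noteq> 2"
    proof
      assume "m = 2"
      then obtain k l where kl: "u = [k, l]" by (auto simp: m_def length_Suc_conv numeral_2_eq_2)
      then have "nbr (nbr v l) k = v" using closed by simp
      moreover have "nbr (nbr v l) l = v" using less.prems(3) u kl by (simp add: nbr_nbr)
      ultimately have "k = l"
        using u kl less.prems(3) by (intro nbr_inj[of "nbr v l"]) (auto intro: nbr_verts)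
      with less.prems(1) kl show False by (simp add: word_Cons)
    qed
    ultimately have m3: "m \<ge> 3" by linarith
    \<comment> \<open>\<open>x 0\<close> is omitted because it equals \<open>x m\<close>; the edge
      from \<open>x 0\<close> to \<open>x 1\<close> closes the cycle.\<close>
    define p where "p = map x [1..<Suc m]"
    have len: "length p = m" by (simp add: p_def)
    have hdp: "hd p = x 1" "last p = x m"
      using m3 by (simp_all add: p_def hd_map last_map del: upt_Suc)
    have "distinct p"
    proof -
      have "inj_on x {1..<Suc m}"
        by (rule linorder_inj_onI) (use neq m3 in auto)
      then show ?thesis by (simp add: p_def distinct_map del: upt_Suc)
    qed
    moreover have "walk \<Delta> p (hd p) (last p)"
      using m3 xv by (auto simp: walk_def p_def successively_map successively_conv_nth
          edge simp del: upt_Suc)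
    moreover have "{last p, hd p} \<in> edges \<Delta>"
      using edge[of 0] m3 by (simp add: hdp xm x0)
    ultimately have "is_cycle \<Delta> p"
      using m3 by (simp add: is_cycle_def len)
    with tree(3) show False by blast
  qed
qed

text \<open>Equal heads cancel. With different heads, going out along one word and back along the
  other is again a reduced word, and it is closed, against \<open>travel_neq\<close>.\<close>

lemma travel_inj:
  assumes "word w" "word w'" "v \<in> verts \<Delta>" "travel w v = travel w' v"
  shows "w = w'"
  using assms
proof (induction w arbitrary: w')
  case Nil
  then show ?case using travel_neq[of w' v] by fastforce
next
  case (Cons k w)
  note ver = travel_verts[OF \<open>v \<in> verts \<Delta>\<close>]
  show ?case
  proof (cases w')
    case Nil
    then show ?thesis using Cons.prems travel_neq[of "k # w" v] by simp
  next
    case (Cons l u)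
    have k: "k \<in> {1..n}" "l \<in> {1..n}" "word w" "word u"
      using Cons.prems \<open>w' = _\<close> by (auto simp: word_Cons)
    have tv: "travel w v \<in> verts \<Delta>" "travel u v \<in> verts \<Delta>"
      using k by (auto intro!: ver simp: word_def)
    show ?thesis
    proof (cases "k = l")
      case True
      then have "travel w v = travel u v"
        using Cons.prems(4) \<open>w' = _\<close> nbr_nbr tv k by (metis travel_simps(2))
      with Cons.IH[of u] k Cons.prems \<open>w' = _\<close> True show ?thesis by simp
    next
      case False
      let ?c = "rev (l # u) @ k # w"
      have undo: "travel (rev s) (travel s v) = v" if "set s \<subseteq> {1..n}" for s
        using that by (induction s) (auto simp: nbr_nbr travel_verts Cons.prems(3))
      have "travel ?c v = travel (rev (l # u)) (travel (l # u) v)"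
        using Cons.prems(4) \<open>w' = _\<close> by simp
      also have "\<dots> = v" using Cons.prems(2) \<open>w' = _\<close> by (intro undo) (simp add: word_def)
      finally have "travel ?c v = v" .
      moreover have "word ?c"
        using Cons.prems \<open>w' = _\<close> False unfolding word_append word_rev by auto
      ultimately show ?thesis using travel_neq[of ?c v] Cons.prems(3) by blast
    qed
  qed
qed

section \<open>Vertices as reduced words: distances and geodesics\<close>

abbreviation V :: "nat list \<Rightarrow> 'v" where
  "V w \<equiv> travel w v0"

text \<open>On reduced words this is left multiplication by the generator \<open>k\<close> in the
  free product of \<open>n\<close> groups of order two, whose Cayley graph is the tree.\<close>

definition move :: "nat \<Rightarrow> nat list \<Rightarrow> nat list" where
  "move k w = (if w \<noteq> [] \<and> hd w = k then tl w else k # w)"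

lemma word_move: "word w \<Longrightarrow> k \<in> {1..n} \<Longrightarrow> word (move k w)"
  by (auto simp: move_def word_Cons word_tl)

lemma V_verts: "word w \<Longrightarrow> V w \<in> verts \<Delta>"
  using root by (intro travel_verts) (auto simp: word_def)

lemma V_move: "word w \<Longrightarrow> k \<in> {1..n} \<Longrightarrow> V (move k w) = nbr (V w) k"
  by (cases w) (auto simp: move_def word_Cons nbr_nbr V_verts)

lemma V_inj: "word w \<Longrightarrow> word w' \<Longrightarrow> V w = V w' \<Longrightarrow> w = w'"
  using travel_inj root by blast

lemma edge_V:
  assumes "word w" "{V w, y} \<in> edges \<Delta>"
  shows "word (move (label \<Delta> {V w, y}) w)" "y = V (move (label \<Delta> {V w, y}) w)"
  using assms edge_label word_move V_move nbr_eqI by metis+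

lemma walk_Cons:
  "walk \<Delta> (x # p) u v \<longleftrightarrow> u = x \<and> x \<in> verts \<Delta> \<and>
     (if p = [] then v = x else {x, hd p} \<in> edges \<Delta> \<and> walk \<Delta> p (hd p) v)"
  by (cases p) (auto simp: walk_def)

text \<open>An edge changes the length of the word by at most one; the inequality is strict because
  \<open>p\<close> lists one vertex more than it has edges. With \<open>v = v0\<close> it bounds
  distances from below, and with \<open>w = []\<close> it provides a word for every vertex.\<close>

lemma walk_from_V:
  assumes "walk \<Delta> p (V w) v" "word w"
  shows "\<exists>w'. word w' \<and> v = V w' \<and> length w < length w' + length p"
  using assms
proof (induction p arbitrary: w)
  case Nil
  then show ?case by (simp add: walk_def)
next
  case (Cons x p)
  show ?case
  proof (cases "p = []")
    case True
    then show ?thesis using Cons.prems by (auto simp: walk_Cons)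
  next
    case False
    then have x: "{V w, hd p} \<in> edges \<Delta>" "walk \<Delta> p (hd p) v"
      using Cons.prems by (auto simp: walk_Cons)
    let ?m = "move (label \<Delta> {V w, hd p}) w"
    obtain w' where "word w'" "v = V w'" "length ?m < length w' + length p"
      using Cons.IH[of ?m] edge_V[OF Cons.prems(2) x(1)] x(2) by metis
    moreover have "length w \<le> Suc (length ?m)" by (auto simp: move_def)
    ultimately show ?thesis by auto
  qed
qed

lemma V_surj:
  assumes "v \<in> verts \<Delta>"
  obtains w where "word w" "v = V w"
proof -
  obtain p where "walk \<Delta> p v0 v"
    using tree(2) assms root by (auto simp: connected_graph_def)
  then show ?thesis using walk_from_V[of p "[]" v] that by auto
qed

lemma walk_to_root: "word w \<Longrightarrow> \<exists>p. walk \<Delta> p (V w) v0 \<and> length p = Suc (length w)"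
proof (induction w)
  case Nil
  then show ?case using root by (intro exI[of _ "[v0]"]) (simp add: walk_def)
next
  case (Cons k w)
  then obtain p where p: "walk \<Delta> p (V w) v0" "length p = Suc (length w)"
    by (auto simp: word_Cons)
  have e: "{V (k # w), V w} \<in> edges \<Delta>"
    using Cons.prems nbr_edge(1)[OF V_verts] by (auto simp: word_Cons insert_commute)
  have "hd p = V w" "p \<noteq> []" using p by (auto simp: walk_def)
  then have "walk \<Delta> (V (k # w) # p) (V (k # w)) v0"
    using p e V_verts[OF Cons.prems] by (simp add: walk_Cons)
  then show ?case using p by fastforce
qed

lemma gdist_V:
  assumes "word w"
  shows "gdist \<Delta> (V w) v0 = length w"
  unfolding gdist_def
proof (rule Least_equality)
  show "\<exists>p. walk \<Delta> p (V w) v0 \<and> length p = Suc (length w)"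
    using walk_to_root[OF assms] .
next
  fix d assume "\<exists>p. walk \<Delta> p (V w) v0 \<and> length p = Suc d"
  then obtain p where p: "walk \<Delta> p (V w) v0" "length p = Suc d" by blast
  then obtain w' where "word w'" "v0 = V w'" "length w < length w' + Suc d"
    using walk_from_V[OF p(1) assms] by metis
  moreover from this have "w' = []" using V_inj[of w' "[]"] by simp
  ultimately show "length w \<le> d" by simp
qed

text \<open>Only the edge labelled by the head shortens the word. After any other first edge the
  word has length \<open>length w + 2\<close>, too long for the remaining edges to reach the
  root.\<close>

lemma geodesic_label:
  assumes "word (k # w)" "geodesic \<Delta> p (V (k # w)) v0"
  shows "label \<Delta> {p ! 0, p ! 1} = k"
proof -
  have len: "length p = Suc (Suc (length w))" and wk: "walk \<Delta> p (V (k # w)) v0"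
    using assms gdist_V[OF assms(1)] by (simp_all add: geodesic_def)
  then obtain x y q where p: "p = x # y # q" by (metis length_Suc_conv)
  let ?l = "label \<Delta> {V (k # w), y}"
  have x: "x = V (k # w)" and e: "{V (k # w), y} \<in> edges \<Delta>" and wk': "walk \<Delta> (y # q) y v0"
    using wk by (auto simp: p walk_Cons split: if_splits)
  note m = edge_V[OF assms(1) e]
  have "\<exists>w'. word w' \<and> v0 = V w' \<and> length (move ?l (k # w)) < length w' + length (y # q)"
    using walk_from_V[of "y # q" "move ?l (k # w)" v0] m wk' by metis
  then obtain w' where w': "word w'" "v0 = V w'"
      "length (move ?l (k # w)) < length w' + length (y # q)" by blast
  then have "w' = []" using V_inj[of w' "[]"] by simp
  with w' len have "length (move ?l (k # w)) < Suc (length w)" by (simp add: p)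
  then have "?l = k" by (auto simp: move_def split: if_splits)
  then show ?thesis by (simp add: p x)
qed

section \<open>Components as sets of words\<close>

lemma dropWhile_move: "k \<in> I \<Longrightarrow> dropWhile (\<lambda>x. x \<in> I) (move k w) = dropWhile (\<lambda>x. x \<in> I) w"
  by (cases w) (auto simp: move_def)

text \<open>An edge with label in \<open>I\<close> leaves unchanged what remains after stripping
  letters of \<open>I\<close>. Conversely, stripping follows a path of edges labelled in
  \<open>I\<close>, so words with equal remainders are joined through the remainder.\<close>

lemma component_V:
  assumes "word w"
  shows "component \<Delta> (V w) I =
    V ` {w'. word w' \<and> dropWhile (\<lambda>x. x \<in> I) w' = dropWhile (\<lambda>x. x \<in> I) w}" (is "_ = V ` ?S w")
proof -
  define R where "R = {(x, y). {x, y} \<in> edges \<Delta> \<and> label \<Delta> {x, y} \<in> I}"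
  have sym: "sym (R\<^sup>*)"
    by (intro sym_rtrancl symI) (auto simp: R_def insert_commute)
  have "y \<in> V ` ?S w" if "(V w, y) \<in> R\<^sup>*" for y
    using that
  proof (induction rule: rtrancl_induct)
    case base
    then show ?case using assms by auto
  next
    case (step y z)
    then obtain w' where w': "word w'" "y = V w'"
      "dropWhile (\<lambda>x. x \<in> I) w' = dropWhile (\<lambda>x. x \<in> I) w" by auto
    have e: "{V w', z} \<in> edges \<Delta>" "label \<Delta> {V w', z} \<in> I"
      using step(2) w' by (auto simp: R_def)
    show ?case
      using edge_V[OF w'(1) e(1)] dropWhile_move[OF e(2)] w'(3) by force
  qed
  moreover have down: "(V w', V (dropWhile (\<lambda>x. x \<in> I) w')) \<in> R\<^sup>*" if "word w'" for w'
    using that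
  proof (induction w')
    case Nil
    then show ?case by simp
  next
    case (Cons k w')
    have "{V (k # w'), V w'} \<in> edges \<Delta>" "label \<Delta> {V (k # w'), V w'} = k"
      using Cons.prems nbr_edge[OF V_verts] by (auto simp: word_Cons insert_commute)
    then have "k \<in> I \<Longrightarrow> (V (k # w'), V w') \<in> R" by (simp add: R_def)
    then show ?case using Cons by (auto simp: word_Cons intro: converse_rtrancl_into_rtrancl)
  qed
  moreover have "(V w, V w') \<in> R\<^sup>*" if "w' \<in> ?S w" for w'
    using down[of w'] down[OF assms] that symD[OF sym] rtrancl_trans by (smt (verit) mem_Collect_eq)
  ultimately show ?thesis by (auto simp: component_def R_def[symmetric])
qed

lemma component_eq_iff:
  assumes "word w" "word w'"
  shows "component \<Delta> (V w) I = component \<Delta> (V w') I \<longleftrightarrow>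
    dropWhile (\<lambda>x. x \<in> I) w = dropWhile (\<lambda>x. x \<in> I) w'"
proof
  assume "component \<Delta> (V w) I = component \<Delta> (V w') I"
  then have "V w \<in> component \<Delta> (V w') I" by (auto simp: component_def)
  then show "dropWhile (\<lambda>x. x \<in> I) w = dropWhile (\<lambda>x. x \<in> I) w'"
    using assms V_inj by (auto simp: component_V)
qed (simp add: component_V assms)

text \<open>The remainder is the shortest word of the component, hence determined by it. It also
  reveals the label set: for a letter \<open>i\<close> of \<open>I \<union> J\<close>, prepending
  \<open>i\<close> to the remainder stays in the component of \<open>I\<close> exactly when
  \<open>i \<in> I\<close>.\<close>

lemma component_eqD:
  assumes "word w" "word w'" "component \<Delta> (V w) I = component \<Delta> (V w') J"
    and "I \<subseteq> {1..n}" "J \<subseteq> {1..n}"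
  shows "dropWhile (\<lambda>x. x \<in> I) w = dropWhile (\<lambda>x. x \<in> J) w'" "I = J"
proof -
  have eq: "{x. word x \<and> dropWhile (\<lambda>x. x \<in> I) x = dropWhile (\<lambda>x. x \<in> I) w} =
    {x. word x \<and> dropWhile (\<lambda>x. x \<in> J) x = dropWhile (\<lambda>x. x \<in> J) w'}" (is "?A = ?B")
  proof -
    have "V ` ?A = V ` ?B" using assms by (simp add: component_V)
    moreover have "inj_on V {x. word x}" by (rule inj_onI) (auto intro: V_inj)
    ultimately show ?thesis by (subst (asm) inj_on_image_eq_iff) auto
  qed
  let ?u = "dropWhile (\<lambda>x. x \<in> I) w" and ?u' = "dropWhile (\<lambda>x. x \<in> J) w'"
  have "?u \<in> ?B" "?u' \<in> ?A"
    using eq word_dropWhile assms dropWhile_idem by blast+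
  then have "length ?u' \<le> length ?u" "length ?u \<le> length ?u'"
    by (metis (mono_tags, lifting) length_dropWhile_le mem_Collect_eq)+
  moreover have *: "\<exists>s. x = s @ dropWhile Q x" for Q and x :: "nat list"
    by (metis takeWhile_dropWhile_id)
  obtain s where "?u = s @ dropWhile (\<lambda>x. x \<in> J) ?u" using * by blast
  moreover have "dropWhile (\<lambda>x. x \<in> J) ?u = ?u'" using \<open>?u \<in> ?B\<close> by simp
  ultimately show u: "?u = ?u'" by (metis append_eq_append_conv append_Nil le_antisym)
  have hd: "?u \<noteq> [] \<Longrightarrow> hd ?u \<notin> I \<and> hd ?u \<notin> J" using u hd_dropWhile by metis
  have "i \<in> I \<longleftrightarrow> i # ?u \<in> ?A" if "i \<in> I \<union> J" for i
    using that hd assms(1,4,5) dropWhile_idem by (auto simp: word_Cons word_dropWhile)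
  moreover have "i \<in> J \<longleftrightarrow> i # ?u \<in> ?B" if "i \<in> I \<union> J" for i
    using that hd assms(2,4,5) dropWhile_idem by (auto simp: word_Cons word_dropWhile u)
  ultimately show "I = J" using eq by blast
qed

end

section \<open>The Fibonacci function on words\<close>

primrec fib_word :: "nat list \<Rightarrow> nat \<Rightarrow> nat \<Rightarrow> nat" where
  "fib_word [] i j = 1"
| "fib_word (k # w) i j =
    (if k \<in> {i, j} then fib_word w i j else fib_word w i k + fib_word w j k)"

lemma fib_word_commute: "fib_word w i j = fib_word w j i"
  by (induction w arbitrary: i j) auto

lemma fib_word_dropWhile: "fib_word (dropWhile (\<lambda>x. x \<in> {i, j}) w) i j = fib_word w i j"
  by (induction w) auto

context rooted_labelled_tree
begin

lemma root_in_component_iff: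
  assumes "word w"
  shows "v0 \<in> component \<Delta> (V w) I \<longleftrightarrow> dropWhile (\<lambda>x. x \<in> I) w = []"
proof
  assume "v0 \<in> component \<Delta> (V w) I"
  then obtain x where "word x" "v0 = V x" "dropWhile (\<lambda>x. x \<in> I) x = dropWhile (\<lambda>x. x \<in> I) w"
    by (auto simp: component_V assms)
  moreover from this have "x = []" using V_inj[of x "[]"] by simp
  ultimately show "dropWhile (\<lambda>x. x \<in> I) w = []" by simp
next
  assume "dropWhile (\<lambda>x. x \<in> I) w = []"
  then have "V [] \<in> component \<Delta> (V w) I"
    unfolding component_V[OF assms] by (intro imageI CollectI) (simp only: dropWhile.simps word_Nil simp_thms)
  then show "v0 \<in> component \<Delta> (V w) I" by simp
qed

text \<open>All words of the component end in the common remainder, so the remainder is the unique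
  shortest one; length is distance to the root by \<open>gdist_V\<close>.\<close>

lemma closest_vertex_iff:
  assumes "word w"
  shows "closest_vertex \<Delta> v0 (component \<Delta> (V w) I) v \<longleftrightarrow> v = V (dropWhile (\<lambda>x. x \<in> I) w)"
    (is "?L \<longleftrightarrow> v = V ?u")
proof
  assume L: ?L
  then obtain x where x: "word x" "v = V x" "dropWhile (\<lambda>x. x \<in> I) x = ?u"
    by (auto simp: component_V assms closest_vertex_def)
  have "V ?u \<in> component \<Delta> (V w) I"
    by (auto simp: component_V assms dropWhile_idem word_dropWhile)
  then have "length x \<le> length ?u"
    using L x assms by (auto simp: closest_vertex_def gdist_V word_dropWhile)
  then have "takeWhile (\<lambda>x. x \<in> I) x = []"
    using x(3) takeWhile_dropWhile_id[of "\<lambda>x. x \<in> I" x]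
    by (metis add_le_same_cancel2 length_append le_zero_eq length_0_conv)
  then have "x = ?u" using x(3) takeWhile_dropWhile_id by (metis append_Nil)
  with x show "v = V ?u" by simp
next
  assume v: "v = V ?u"
  show ?L unfolding closest_vertex_def
  proof (intro conjI ballI)
    show "v \<in> component \<Delta> (V w) I"
      by (auto simp: component_V assms dropWhile_idem word_dropWhile v)
  next
    fix y assume "y \<in> component \<Delta> (V w) I"
    then obtain x where x: "word x" "y = V x" "dropWhile (\<lambda>x. x \<in> I) x = ?u"
      by (auto simp: component_V assms)
    then have "length ?u \<le> length x" by (metis length_dropWhile_le)
    then show "gdist \<Delta> v v0 \<le> gdist \<Delta> y v0"
      using x assms v by (simp add: gdist_V word_dropWhile)
  qed
qed

lemma component_dropWhile:
  "word w \<Longrightarrow> component \<Delta> (V (dropWhile (\<lambda>x. x \<in> I) w)) I = component \<Delta> (V w) I"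
  by (subst component_eq_iff) (auto simp: word_dropWhile dropWhile_idem)

lemma component_Cons:
  "word (k # w) \<Longrightarrow> k \<in> I \<Longrightarrow> component \<Delta> (V (k # w)) I = component \<Delta> (V w) I"
  by (subst component_eq_iff) (auto simp: word_Cons)

lemma alt_geodesicI:
  "word w \<Longrightarrow> i \<in> {1..n} \<Longrightarrow> j \<in> {1..n} \<Longrightarrow> i \<noteq> j \<Longrightarrow>
    component \<Delta> (V w) {i, j} \<in> alt_geodesics n \<Delta>"
  using V_verts unfolding alt_geodesics_def by blast

lemma alt_geodesicE:
  assumes "\<gamma> \<in> alt_geodesics n \<Delta>"
  obtains w i j where "word w" "i \<in> {1..n}" "j \<in> {1..n}" "i \<noteq> j" "\<gamma> = component \<Delta> (V w) {i, j}"
proof -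
  obtain v i j where v: "v \<in> verts \<Delta>" "i \<in> {1..n}" "j \<in> {1..n}" "i \<noteq> j" "\<gamma> = component \<Delta> v {i, j}"
    using assms unfolding alt_geodesics_def by blast
  obtain w where "word w" "v = V w" using V_surj v(1) .
  then show ?thesis using that v by blast
qed

text \<open>Existence of a value. The rule passes from the stripped word \<open>k # s\<close> to the
  pairs \<open>{i, k}\<close> and \<open>{j, k}\<close>; both contain \<open>k\<close>, so the two
  new geodesics also pass through the vertex of \<open>s\<close>. This is why
  \<open>fib_word\<close> recurses on the tail.\<close>

lemma fib_graph_V:
  assumes "word w" "i \<in> {1..n}" "j \<in> {1..n}" "i \<noteq> j"
  shows "fib_graph n \<Delta> v0 (component \<Delta> (V w) {i, j}) (fib_word w i j)"
  using assms
proof (induction "length w" arbitrary: w i j rule: less_induct)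
  case less
  let ?u = "dropWhile (\<lambda>x. x \<in> {i, j}) w"
  have F: "fib_word w i j = fib_word ?u i j" by (rule fib_word_dropWhile[symmetric])
  have wu: "word ?u" using less.prems word_dropWhile by blast
  show ?case
  proof (cases ?u)
    case Nil
    then have "v0 \<in> component \<Delta> (V w) {i, j}"
      using root_in_component_iff less.prems by simp
    then show ?thesis unfolding F Nil using alt_geodesicI[OF less.prems] fib_graph.base by simp
  next
    case (Cons k s)
    then have k: "k \<notin> {i, j}" "k \<in> {1..n}" "word s"
      using hd_dropWhile[of "\<lambda>x. x \<in> {i, j}" w] wu by (auto simp: word_Cons)
    have len: "length s < length w" using Cons length_dropWhile_le[of "\<lambda>x. x \<in> {i, j}" w] by simp
    obtain p where "walk \<Delta> p (V ?u) v0" "length p = Suc (length ?u)"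
      using walk_to_root wu by blast
    then have p: "geodesic \<Delta> p (V (k # s)) v0"
      using gdist_V[OF wu] Cons by (simp add: geodesic_def)
    have "fib_graph n \<Delta> v0 (component \<Delta> (V w) {i, j}) (fib_word s i k + fib_word s j k)"
    proof (rule fib_graph.step[where v = "V (k # s)" and i = i and j = j and p = p and k = k])
      show "component \<Delta> (V w) {i, j} \<in> alt_geodesics n \<Delta>" using alt_geodesicI less.prems by simp
      show "v0 \<notin> component \<Delta> (V w) {i, j}"
        unfolding root_in_component_iff[OF less.prems(1)] Cons by simp
      show "closest_vertex \<Delta> v0 (component \<Delta> (V w) {i, j}) (V (k # s))"
        unfolding closest_vertex_iff[OF less.prems(1)] Cons ..
      show "component \<Delta> (V w) {i, j} = component \<Delta> (V (k # s)) {i, j}"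
        using component_dropWhile[of w "{i, j}"] less.prems(1) Cons by metis
      show "k = label \<Delta> {p ! 0, p ! 1}" using geodesic_label p wu Cons by metis
      show "fib_graph n \<Delta> v0 (component \<Delta> (V (k # s)) {i, k}) (fib_word s i k)"
        using component_Cons[of k s "{i, k}"] wu[unfolded Cons] less.hyps[OF len k(3) less.prems(2) k(2)] k(1)
        by auto
      show "fib_graph n \<Delta> v0 (component \<Delta> (V (k # s)) {j, k}) (fib_word s j k)"
        using component_Cons[of k s "{j, k}"] wu[unfolded Cons] less.hyps[OF len k(3) less.prems(3) k(2)] k(1)
        by auto
    qed (use less.prems p in simp_all)
    then show ?thesis unfolding F Cons using k by simp
  qed
qed

lemma fib_graph_unique:
  assumes "fib_graph n \<Delta> v0 \<gamma> m" "\<gamma> = component \<Delta> (V w) {i, j}"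
    and "word w" "i \<in> {1..n}" "j \<in> {1..n}" "i \<noteq> j"
  shows "m = fib_word w i j"
  using assms
proof (induction arbitrary: w i j rule: fib_graph.induct)
  case (base \<gamma>)
  then have "dropWhile (\<lambda>x. x \<in> {i, j}) w = []" using root_in_component_iff by metis
  then show ?case using fib_word_dropWhile[of i j w] by (metis fib_word.simps(1))
next
  case (step \<gamma> v i' j' p k a b)
  let ?u = "dropWhile (\<lambda>x. x \<in> {i, j}) w"
  have wu: "word ?u" using step.prems word_dropWhile by blast
  have v: "v = V ?u" using step.hyps(3) step.prems closest_vertex_iff by metis
  have "?u \<noteq> []" using step.hyps(2) step.prems root_in_component_iff by metis
  then obtain l s where u: "?u = l # s" by (cases ?u) auto
  have l: "l \<notin> {i, j}" "l \<in> {1..n}"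
    using u hd_dropWhile[of "\<lambda>x. x \<in> {i, j}" w] wu by (auto simp: word_Cons)
  have k: "k = l"
    unfolding step.hyps(9) by (rule geodesic_label[of l s]) (use wu step.hyps(8) u v in simp_all)
  have "component \<Delta> (V ?u) {i', j'} = component \<Delta> (V ?u) {i, j}"
    using component_dropWhile[OF step.prems(2), of "{i, j}"] step.hyps(7) step.prems(1) v by metis
  \<comment> \<open>The rule may use the two labels in either order. The component determines only
    the unordered pair, and \<open>fib_word_commute\<close> absorbs a swap.\<close>
  then have ij: "{i', j'} = {i, j}"
    by (rule component_eqD(2)[OF wu wu]) (use step.hyps(4,5) step.prems(3,4) in simp_all)
  then have l': "l \<notin> {i', j'}" using l by simp
  have "k \<in> {1..n}" "i' \<noteq> k" "j' \<noteq> k" using k l(2) l' by blast+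
  then have "a = fib_word ?u i' k" "b = fib_word ?u j' k"
    using step.IH(1)[OF _ wu step.hyps(4)] step.IH(2)[OF _ wu step.hyps(5)] unfolding v by metis+
  then have "a + b = fib_word ?u i' j'" using u k l' by simp
  also have "\<dots> = fib_word ?u i j"
    using ij fib_word_commute by (metis doubleton_eq_iff)
  also have "\<dots> = fib_word w i j" by (rule fib_word_dropWhile)
  finally show ?case .
qed

lemma fibonacci_V:
  assumes "word w" "i \<in> {1..n}" "j \<in> {1..n}" "i \<noteq> j"
  shows "fibonacci n \<Delta> v0 (component \<Delta> (V w) {i, j}) = fib_word w i j"
  unfolding fibonacci_def using fib_graph_V[OF assms] fib_graph_unique assms by blast

end

section \<open>Hurwitz maps and the Bowditch conditions on words\<close>

locale bowditch = rooted_labelled_tree n \<Delta> v0 for n and \<Delta> :: "'v labelled_graph" and v0 +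
  fixes \<phi> :: "'v set \<Rightarrow> complex"
  assumes n3: "n \<ge> 3" and bowditch: "\<phi> \<in> bowditch_maps n \<Delta>"
begin

definition a :: "nat \<Rightarrow> nat list \<Rightarrow> complex" where
  "a k w = \<phi> (component \<Delta> (V w) (hat n k))"

text \<open>One product in several roles: for a pair it is the value on a geodesic, for a singleton
  the right-hand side of the edge relation, and for a triple the common factor of the values on the
  three geodesics at \<open>w\<close> with labels in the triple.\<close>

definition P :: "nat list \<Rightarrow> nat set \<Rightarrow> complex" where
  "P w I = (\<Prod>k\<in>{1..n} - I. a k w)"

lemma a_Cons: "word (k # w) \<Longrightarrow> j \<noteq> k \<Longrightarrow> a j (k # w) = a j w"
  unfolding a_def by (subst component_Cons) (auto simp: word_Cons hat_def)

lemma a_edge: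
  assumes "word (k # w)"
  shows "a k (k # w) + a k w = P w {k}"
proof -
  have "hurwitz_map n \<Delta> \<phi>" using bowditch by (simp add: bowditch_maps_def)
  moreover have "{V w, V (k # w)} \<in> edges \<Delta>" "label \<Delta> {V w, V (k # w)} = k"
    using assms nbr_edge[OF V_verts] by (auto simp: word_Cons)
  ultimately show ?thesis unfolding hurwitz_map_def a_def P_def by (metis add.commute)
qed

lemma P_Cons: "word (k # w) \<Longrightarrow> k \<in> I \<Longrightarrow> P (k # w) I = P w I"
  unfolding P_def by (intro prod.cong) (auto intro: a_Cons)

lemma P_dropWhile: "word w \<Longrightarrow> P (dropWhile (\<lambda>x. x \<in> I) w) I = P w I"
  by (induction w) (auto simp: P_Cons word_Cons)

text \<open>The definite description is justified by \<open>component_eqD\<close>: a geodesic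
  determines its label pair and its stripped word, and \<open>P\<close> depends on nothing
  more.\<close>

lemma hurwitz_ext_V:
  assumes "word w" "i \<in> {1..n}" "j \<in> {1..n}" "i \<noteq> j"
  shows "hurwitz_ext n \<Delta> \<phi> (component \<Delta> (V w) {i, j}) = P w {i, j}"
  unfolding hurwitz_ext_def
proof (rule the_equality)
  show "\<exists>v i' j'. v \<in> verts \<Delta> \<and> i' \<in> {1..n} \<and> j' \<in> {1..n} \<and> i' \<noteq> j' \<and>
      component \<Delta> (V w) {i, j} = component \<Delta> v {i', j'} \<and>
      P w {i, j} = (\<Prod>k\<in>{1..n} - {i', j'}. \<phi> (component \<Delta> v (hat n k)))"
    using assms V_verts unfolding P_def a_def by blast
next
  fix z assume "\<exists>v i' j'. v \<in> verts \<Delta> \<and> i' \<in> {1..n} \<and> j' \<in> {1..n} \<and> i' \<noteq> j' \<and>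
      component \<Delta> (V w) {i, j} = component \<Delta> v {i', j'} \<and>
      z = (\<Prod>k\<in>{1..n} - {i', j'}. \<phi> (component \<Delta> v (hat n k)))"
  then obtain v i' j' where v: "v \<in> verts \<Delta>" "i' \<in> {1..n}" "j' \<in> {1..n}" "i' \<noteq> j'"
      "component \<Delta> (V w) {i, j} = component \<Delta> v {i', j'}"
      "z = (\<Prod>k\<in>{1..n} - {i', j'}. \<phi> (component \<Delta> v (hat n k)))" by blast
  obtain x where x: "word x" "v = V x" using V_surj v(1) .
  have z: "z = P x {i', j'}" unfolding v(6) x(2) P_def a_def ..
  have sub: "{i, j} \<subseteq> {1..n}" "{i', j'} \<subseteq> {1..n}" using assms v by simp_all
  note component_eqD[OF assms(1) x(1) v(5)[unfolded x(2)] sub]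
  then show "z = P w {i, j}"
    unfolding z using P_dropWhile[OF x(1)] P_dropWhile[OF assms(1)] by metis
qed

lemma B1:
  assumes "word w" "i \<in> {1..n}" "j \<in> {1..n}" "i \<noteq> j"
  shows "P w {i, j} \<notin> complex_of_real ` {-2..2}"
  using bowditch alt_geodesicI[OF assms] hurwitz_ext_V[OF assms]
  unfolding bowditch_maps_def bowditch_B1_def by auto

definition pairs :: "nat set set" where
  "pairs = {{i, j} |i j. i \<in> {1..n} \<and> j \<in> {1..n} \<and> i \<noteq> j}"

text \<open>Representing a geodesic by its stripped word and its label pair makes the representation
  unique, so that (B2) gives finiteness of this set.\<close>

definition exceptional :: "real \<Rightarrow> (nat list \<times> nat set) set" where
  "exceptional K = {(w, I). word w \<and> I \<in> pairs \<and> dropWhile (\<lambda>x. x \<in> I) w = w \<and> norm (P w I) \<le> K}"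

lemma finite_exceptional:
  obtains K where "K > 2" "finite (exceptional K)"
    "finite {\<gamma> \<in> alt_geodesics n \<Delta>. norm (hurwitz_ext n \<Delta> \<phi> \<gamma>) \<le> K}"
proof -
  obtain K where K: "K > 2" "finite {\<gamma> \<in> alt_geodesics n \<Delta>. norm (hurwitz_ext n \<Delta> \<phi> \<gamma>) \<le> K}"
    using bowditch unfolding bowditch_maps_def bowditch_B2_def by blast
  let ?f = "\<lambda>(w, I). component \<Delta> (V w) I"
  have "?f ` exceptional K \<subseteq> {\<gamma> \<in> alt_geodesics n \<Delta>. norm (hurwitz_ext n \<Delta> \<phi> \<gamma>) \<le> K}"
    by (auto simp: exceptional_def pairs_def alt_geodesicI hurwitz_ext_V)
  then have "finite (?f ` exceptional K)" using K(2) finite_subset by blast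
  moreover have "inj_on ?f (exceptional K)"
  proof (rule inj_onI, clarify)
    fix w I w' I'
    assume asm: "(w, I) \<in> exceptional K" "(w', I') \<in> exceptional K"
      "component \<Delta> (V w) I = component \<Delta> (V w') I'"
    have "I \<subseteq> {1..n}" "I' \<subseteq> {1..n}" using asm by (auto simp: exceptional_def pairs_def)
    then show "w = w' \<and> I = I'"
      using component_eqD[of w w' I I'] asm by (simp add: exceptional_def)
  qed
  ultimately have "finite (exceptional K)" by (rule finite_imageD)
  with K that show ?thesis by blast
qed

end

section \<open>Exponential growth of linear recurrences\<close>

lemma norm_root_of_trace:
  fixes p :: complex
  assumes "p \<notin> complex_of_real ` {-2..2}"
  obtains t where "norm t > 1" "p = t + inverse t"
proof -
  \<comment> \<open>\<open>t\<close> will be a root of \<open>z * z - p * z + 1\<close>; the other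
    root is \<open>inverse t\<close>.\<close>
  define d where "d = csqrt (p\<^sup>2 - 4)"
  define t where "t = (p + d) / 2"
  have d2: "d * d = p * p - 4" unfolding d_def by (metis power2_csqrt power2_eq_square)
  have prod: "t * ((p - d) / 2) = 1" using d2 by (simp add: t_def field_simps)
  then have t0: "t \<noteq> 0" by auto
  have inv: "inverse t = (p - d) / 2" by (rule inverse_unique[OF prod])
  have p: "p = t + inverse t" unfolding inv by (simp add: t_def field_simps)
  \<comment> \<open>On the unit circle the inverse is the conjugate, which makes \<open>p\<close>
    equal to \<open>2 * Re t\<close>, a real number in the excluded interval.\<close>
  have "norm t \<noteq> 1"
  proof
    assume n1: "norm t = 1"
    then have "t * cnj t = 1" by (simp flip: complex_norm_square)
    then have "inverse t = cnj t" by (rule inverse_unique)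
    then have "p = complex_of_real (2 * Re t)" using p by (simp add: complex_add_cnj)
    moreover have "2 * Re t \<in> {-2..2}" using abs_Re_le_cmod[of t] n1 by auto
    ultimately show False using assms by blast
  qed
  then consider "norm t > 1" | "norm (inverse t) > 1"
    using t0 by (force simp: norm_inverse one_less_inverse_iff)
  then show ?thesis
  proof cases
    case 1
    then show ?thesis using that p by blast
  next
    case 2
    then show ?thesis using that[of "inverse t"] p by (simp add: add.commute)
  qed
qed

text \<open>The solution is \<open>A * t ^ m - D * s ^ m\<close> with \<open>s = inverse t\<close>
  of norm below 1. If \<open>A\<close> vanished, \<open>b\<close> would tend to 0, against the lower
  bound; so the first term dominates.\<close>

lemma linear_recurrence_growth:
  fixes b :: "nat \<Rightarrow> complex"
  assumes rec: "\<And>m. b (Suc (Suc m)) = p * b (Suc m) - b m"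
    and p: "p \<notin> complex_of_real ` {-2..2}"
    and lower: "\<delta> > 0" "\<forall>\<^sub>F m in sequentially. norm (b m) \<ge> \<delta>"
  obtains c where "c > 0"
    "\<forall>\<^sub>F m in sequentially. ln (norm (b m)) \<ge> c * real m \<and> norm (b (Suc (Suc m))) \<ge> norm (b m)"
proof -
  obtain t where t: "norm t > 1" "p = t + inverse t" using norm_root_of_trace[OF p] .
  define s where "s = inverse t"
  have t0: "t \<noteq> 0" using t by auto
  have s: "norm s < 1" "t * s = 1" "p = t + s"
    using t t0 by (auto simp: s_def norm_inverse inverse_less_1_iff)
  have st: "s * t = 1" using s(2) by (simp add: mult.commute)
  have ts: "t - s \<noteq> 0" using t s by auto
  have u: "b (Suc m) - s * b m = t ^ m * (b 1 - s * b 0)" for m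
  proof (induction m)
    case (Suc m)
    have "b (Suc (Suc m)) - s * b (Suc m) = t * b (Suc m) - (t * s) * b m"
      by (simp add: rec s(2,3) algebra_simps st)
    also have "\<dots> = t * (b (Suc m) - s * b m)" by (simp add: algebra_simps)
    finally show ?case using Suc by simp
  qed simp
  have v: "b (Suc m) - t * b m = s ^ m * (b 1 - t * b 0)" for m
  proof (induction m)
    case (Suc m)
    have "b (Suc (Suc m)) - t * b (Suc m) = s * b (Suc m) - (t * s) * b m"
      by (simp add: rec s(2,3) algebra_simps st)
    also have "\<dots> = s * (b (Suc m) - t * b m)" by (simp add: algebra_simps)
    finally show ?case using Suc by simp
  qed simp
  define A where "A = (b 1 - s * b 0) / (t - s)"
  define D where "D = (b 1 - t * b 0) / (t - s)"
  have b: "b m = A * t ^ m - D * s ^ m" for m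
  proof -
    have "(t - s) * b m = t ^ m * (b 1 - s * b 0) - s ^ m * (b 1 - t * b 0)"
      unfolding u[of m, symmetric] v[of m, symmetric] by (simp add: algebra_simps)
    then have "b m = (t ^ m * (b 1 - s * b 0) - s ^ m * (b 1 - t * b 0)) / (t - s)"
      using ts by (metis nonzero_mult_div_cancel_left)
    then show ?thesis by (simp add: A_def D_def mult.commute flip: diff_divide_distrib)
  qed
  have s_lim: "(\<lambda>m. D * s ^ m) \<longlonglongrightarrow> D * 0"
    by (intro tendsto_intros LIMSEQ_power_zero s)
  have A0: "A \<noteq> 0"
  proof
    assume "A = 0"
    then have "b = (\<lambda>m. - (D * s ^ m))" by (auto simp: b)
    then have "b \<longlonglongrightarrow> 0" using tendsto_minus[OF s_lim] by simp
    then have "\<forall>\<^sub>F m in sequentially. norm (b m) < \<delta>"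
      using tendstoD[of b 0 sequentially \<delta>] lower(1) by simp
    with lower(2) have "\<forall>\<^sub>F m in sequentially. False"
      by eventually_elim simp
    then show False by simp
  qed
  define q where "q m = b m / t ^ m" for m
  have "norm (s / t) < 1" using s t t0 by (simp add: norm_divide divide_simps)
  then have "(\<lambda>m. A - D * (s / t) ^ m) \<longlonglongrightarrow> A - D * 0"
    by (intro tendsto_intros LIMSEQ_power_zero)
  moreover have "q = (\<lambda>m. A - D * (s / t) ^ m)"
    using t0 by (auto simp: q_def b diff_divide_distrib power_divide)
  ultimately have q: "q \<longlonglongrightarrow> A" by simp
  have bq: "norm (b m) = norm (q m) * norm t ^ m" for m
    using t0 by (simp add: q_def norm_divide norm_power)
  have "(\<lambda>m. norm (q m)) \<longlonglongrightarrow> norm A" using q by (rule tendsto_norm)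
  moreover have "norm A / 2 < norm A" using A0 by simp
  ultimately have ev1: "\<forall>\<^sub>F m in sequentially. norm (q m) > norm A / 2"
    by (rule order_tendstoD)
  \<comment> \<open>In the limit two steps multiply the norm by \<open>(norm t)\<^sup>2\<close>,
    which exceeds 1. Two steps are compared because \<open>b m\<close> and \<open>b (m + 2)\<close>
    will be the values at the ends of one edge.\<close>
  have "(\<lambda>m. norm (q (m + 2)) * (norm t)\<^sup>2 - norm (q m)) \<longlonglongrightarrow> norm A * (norm t)\<^sup>2 - norm A"
    using q by (intro tendsto_intros LIMSEQ_ignore_initial_segment)
  moreover have "norm A * (norm t)\<^sup>2 - norm A > 0"
    using A0 t by (simp add: power2_eq_square) (metis less_1_mult)
  ultimately have ev2: "\<forall>\<^sub>F m in sequentially. norm (q (m + 2)) * (norm t)\<^sup>2 - norm (q m) > 0"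
    by (rule order_tendstoD)
  \<comment> \<open>Half of the growth rate: the other half eventually outweighs the constant
    \<open>ln (norm A / 2)\<close>.\<close>
  define c where "c = ln (norm t) / 2"
  have c: "c > 0" using ln_gt_zero[OF t(1)] by (simp add: c_def)
  have "filterlim (\<lambda>m. c * real m) at_top sequentially"
    using c by (intro filterlim_tendsto_pos_mult_at_top[OF tendsto_const _ filterlim_real_sequentially])
  then have ev3: "\<forall>\<^sub>F m in sequentially. c * real m \<ge> - ln (norm A / 2)"
    by (simp add: filterlim_at_top)
  have "\<forall>\<^sub>F m in sequentially. ln (norm (b m)) \<ge> c * real m \<and> norm (b (Suc (Suc m))) \<ge> norm (b m)"
    using ev1 ev2 ev3
  proof eventually_elim
    case (elim m)
    have tm: "norm t ^ m > 0" using t0 by simp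
    have "norm (b m) \<ge> norm A / 2 * norm t ^ m"
      unfolding bq using elim(1) tm by (intro mult_right_mono) auto
    then have "ln (norm (b m)) \<ge> ln (norm A / 2 * norm t ^ m)"
      using A0 tm by (intro ln_mono) simp_all
    also have "ln (norm A / 2 * norm t ^ m) = ln (norm A / 2) + 2 * c * real m"
      using A0 t0 by (subst ln_mult) (simp_all add: ln_realpow c_def)
    finally have "ln (norm (b m)) \<ge> c * real m" using elim(3) by (simp add: algebra_simps)
    moreover have "norm (b m) \<le> (norm (q (m + 2)) * (norm t)\<^sup>2) * norm t ^ m"
      unfolding bq using elim(2) tm by (intro mult_right_mono) auto
    then have "norm (b m) \<le> norm (b (Suc (Suc m)))"
      unfolding bq[of "Suc (Suc m)"] by (simp add: power2_eq_square mult_ac)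
    ultimately show ?case by simp
  qed
  with c that show ?thesis by blast
qed

section \<open>Uniform positive constants, and rays along alternating geodesics\<close>

lemma finite_common_positive:
  fixes Q :: "real \<Rightarrow> 'a \<Rightarrow> bool"
  assumes "finite S" "\<And>s. s \<in> S \<Longrightarrow> \<exists>c>0. Q c s"
    and mono: "\<And>c c' s. Q c s \<Longrightarrow> 0 < c' \<Longrightarrow> c' \<le> c \<Longrightarrow> Q c' s"
  shows "\<exists>c>0. \<forall>s\<in>S. Q c s"
  using assms(1,2)
proof (induction S)
  case empty
  then show ?case by (auto intro: exI[of _ 1])
next
  case (insert x S)
  then obtain c c' where c: "c > 0" "\<forall>s\<in>S. Q c s" "c' > 0" "Q c' x" by (meson insertCI)
  then have "min c c' > 0" "\<forall>s\<in>insert x S. Q (min c c') s"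
    by (auto intro: mono[of c _ "min c c'"] mono[of c' _ "min c c'"])
  then show ?case by blast
qed

text \<open>The words \<open>ray x y u m\<close> run along the alternating geodesic \<open>[u;{x, y}]\<close>, starting at \<open>u\<close>
  with label \<open>x\<close>; the \<open>m\<close>-th step has label \<open>alt x y m\<close>.\<close>

definition alt :: "nat \<Rightarrow> nat \<Rightarrow> nat \<Rightarrow> nat" where
  "alt x y m = (if even m then y else x)"

primrec ray :: "nat \<Rightarrow> nat \<Rightarrow> nat list \<Rightarrow> nat \<Rightarrow> nat list" where
  "ray x y u 0 = u"
| "ray x y u (Suc m) = alt x y (Suc m) # ray x y u m"

lemma alt_Suc_Suc [simp]: "alt x y (Suc (Suc m)) = alt x y m"
  by (simp add: alt_def)

lemma alt_Suc_neq: "x \<noteq> y \<Longrightarrow> alt x y (Suc m) \<noteq> alt x y m"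
  by (simp add: alt_def)

lemma alt_in: "alt x y m \<in> {x, y}"
  by (simp add: alt_def)

lemma alt_doubleton: "{alt x y (Suc m), alt x y m} = {x, y}"
  by (auto simp: alt_def)

lemma length_ray: "length (ray x y u m) = length u + m"
  by (induction m) auto

lemma fib_word_ray: "fib_word (ray x y u m) x y = fib_word u x y"
  by (induction m) (use alt_in in auto)

text \<open>Each further step along the ray adds the value of the geodesic that carries the ray, and
  this value is constant by \<open>fib_word_ray\<close>. Hence the growth is linear.\<close>

lemma fib_word_ray_crossing:
  assumes "x \<noteq> y" "j \<notin> {x, y}"
  shows "fib_word (ray x y u m) (alt x y (Suc m)) j = fib_word u x j + m * fib_word u x y"
proof (induction m)
  case 0
  then show ?case by (simp add: alt_def)
next
  case (Suc m)
  have "fib_word (ray x y u m) (alt x y m) (alt x y (Suc m)) = fib_word (ray x y u m) x y"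
    using alt_doubleton[of x y m] fib_word_commute by (metis doubleton_eq_iff)
  moreover have "alt x y (Suc m) \<noteq> j" using alt_in[of x y "Suc m"] assms by auto
  moreover have "fib_word (ray x y u m) j (alt x y (Suc m)) = fib_word u x j + m * fib_word u x y"
    using Suc fib_word_commute by metis
  ultimately show ?case using alt_Suc_neq[OF assms(1), of m] by (simp add: fib_word_ray)
qed

lemma fib_word_pos: "fib_word w i j > 0"
  by (induction w arbitrary: i j) auto

context rooted_labelled_tree
begin

lemma word_ray:
  assumes "word u" "x \<in> {1..n}" "y \<in> {1..n}" "x \<noteq> y" "dropWhile (\<lambda>k. k \<in> {x, y}) u = u"
  shows "word (ray x y u m)"
proof (induction m)
  case 0
  then show ?case using assms by simp
next
  case (Suc m)
  have "alt x y (Suc m) \<in> {1..n}" using alt_in[of x y "Suc m"] assms by auto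
  moreover have "hd (ray x y u m) \<noteq> alt x y (Suc m)" if "ray x y u m \<noteq> []"
  proof (cases m)
    case 0
    then have "hd u \<notin> {x, y}" using that assms(5) hd_dropWhile[of "\<lambda>k. k \<in> {x, y}" u] by auto
    then show ?thesis using 0 alt_in[of x y "Suc m"] by auto
  next
    case (Suc l)
    then show ?thesis using alt_Suc_neq[OF assms(4)] by (metis list.sel(1) ray.simps(2))
  qed
  ultimately show ?case using Suc by (simp add: word_Cons)
qed

text \<open>A reduced word in two letters alternates. The letter \<open>k\<close> in front decides
  which of the two comes first in the ray, also when nothing is stripped from
  \<open>w\<close>.\<close>

lemma word_eq_ray:
  assumes "word (k # w)" "k \<in> {i, j}" "i \<noteq> j"
  shows "\<exists>x y m. {x, y} = {i, j} \<and> w = ray x y (dropWhile (\<lambda>l. l \<in> {i, j}) w) m \<and> k = alt x y (Suc m)"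
  using assms(1,2)
proof (induction w arbitrary: k)
  case Nil
  then obtain l where "{k, l} = {i, j}" by auto
  then show ?case by (intro exI[of _ k] exI[of _ l] exI[of _ 0]) (simp add: alt_def)
next
  case (Cons h w)
  show ?case
  proof (cases "h \<in> {i, j}")
    case True
    moreover have "word (h # w)" "k \<noteq> h" using Cons.prems(1) by (auto simp: word_Cons)
    ultimately obtain x y m where *: "{x, y} = {i, j}" "w = ray x y (dropWhile (\<lambda>l. l \<in> {i, j}) w) m"
      "h = alt x y (Suc m)" using Cons.IH[of h] by metis
    have "k \<in> {alt x y (Suc m), alt x y m}"
      unfolding alt_doubleton *(1) by (rule Cons.prems(2))
    with \<open>k \<noteq> h\<close> have "k = alt x y (Suc (Suc m))" using *(3) by auto
    moreover have "h # w = ray x y (dropWhile (\<lambda>l. l \<in> {i, j}) w) (Suc m)"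
      using *(2,3) by simp
    moreover have "dropWhile (\<lambda>l. l \<in> {i, j}) (h # w) = dropWhile (\<lambda>l. l \<in> {i, j}) w"
      using True by simp
    ultimately show ?thesis using *(1) by metis
  next
    case False
    obtain l where "{k, l} = {i, j}" using Cons.prems by auto
    then show ?thesis using False
      by (intro exI[of _ k] exI[of _ l] exI[of _ 0]) (simp add: alt_def)
  qed
qed

lemma finite_words: "finite {w. word w \<and> length w \<le> L}"
proof (rule finite_subset)
  show "{w. word w \<and> length w \<le> L} \<subseteq> {w. set w \<subseteq> {1..n} \<and> length w \<le> L}" by (auto simp: word_def)
qed (simp add: finite_lists_length_le)

end

section \<open>Nonvanishing of the values and the direction of edges\<close>

context bowditch
begin

lemma pair_avoiding:
  assumes "k \<in> {1..n}"
  obtains i j where "i \<in> {1..n}" "j \<in> {1..n}" "i \<noteq> j" "k \<notin> {i, j}"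
proof -
  have "card ({1..n} - {k}) \<ge> 2" using n3 assms by simp
  then obtain T where "T \<subseteq> {1..n} - {k}" "card T = 2" by (meson obtain_subset_with_card_n)
  moreover from this obtain i j where "T = {i, j}" "i \<noteq> j" by (meson card_2_iff)
  ultimately show ?thesis using that by blast
qed

lemma label_avoiding:
  assumes "i \<in> {1..n}" "j \<in> {1..n}"
  obtains k where "k \<in> {1..n}" "k \<notin> {i, j}"
proof -
  have "card {i, j} \<le> 2" by (simp add: card_insert_if)
  then have "\<not> {1..n} \<subseteq> {i, j}" using n3 card_mono[of "{i, j}" "{1..n}"] by fastforce
  then show ?thesis using that by blast
qed

lemma P_split:
  assumes "k \<in> {1..n}" "k \<notin> I"
  shows "P w I = a k w * P w (insert k I)"
proof -
  have eq: "{1..n} - I = insert k ({1..n} - insert k I)" using assms by auto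
  show ?thesis unfolding P_def eq by (rule prod.insert) auto
qed

lemma P_pair_nonzero:
  assumes "word w" "i \<in> {1..n}" "j \<in> {1..n}" "i \<noteq> j"
  shows "P w {i, j} \<noteq> 0"
proof -
  have "(0::complex) \<in> complex_of_real ` {-2..2}"
    by (rule image_eqI[of _ _ 0]) simp_all
  then show ?thesis using B1[OF assms] by auto
qed

text \<open>With at least three labels, \<open>a k w\<close> is a factor of the value on some
  geodesic through the vertex, and (B1) makes that value nonzero.\<close>

lemma a_nonzero:
  assumes "word w" "k \<in> {1..n}"
  shows "a k w \<noteq> 0"
proof -
  obtain i j where ij: "i \<in> {1..n}" "j \<in> {1..n}" "i \<noteq> j" "k \<notin> {i, j}"
    using pair_avoiding assms(2) by blast
  show ?thesis
    using P_pair_nonzero[OF assms(1) ij(1-3)] unfolding P_split[OF assms(2) ij(4)] mult_eq_0_iff by blast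
qed

lemma P_nonzero: "word w \<Longrightarrow> P w I \<noteq> 0"
  by (simp add: P_def a_nonzero)

lemma P_single: "i \<in> {1..n} \<Longrightarrow> i \<noteq> j \<Longrightarrow> P w {j} = a i w * P w {i, j}"
  by (rule P_split) auto

text \<open>For a bad word the edge to its parent, directed towards the end with the smaller value, points
  away from the root.\<close>

definition bad :: "nat list \<Rightarrow> bool" where
  "bad w \<longleftrightarrow> w \<noteq> [] \<and> norm (a (hd w) w) < norm (a (hd w) (tl w))"

lemma bad_Cons: "bad (k # w) \<longleftrightarrow> norm (a k (k # w)) < norm (a k w)"
  by (simp add: bad_def)

text \<open>If two edges at a vertex both point away from it, then their alternating geodesic has
  norm at most 2. Hence outside the exceptional geodesics the parent of a bad word is bad.\<close>

lemma bad_parent: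
  assumes w: "word (k # h # w)" and bad: "bad (k # h # w)"
    and K: "K > 2" "norm (P (h # w) {h, k}) > K"
  shows "bad (h # w)" "K * norm (a h (h # w)) \<le> 2 * norm (a k (h # w))"
proof -
  let ?v = "h # w"
  have wv: "word ?v" "h \<in> {1..n}" "k \<in> {1..n}" "h \<noteq> k"
    using w by (auto simp: word_Cons)
  \<comment> \<open>The edge relation across \<open>k\<close>; badness makes the value at the parent
    the larger of the two summands.\<close>
  have "norm (a h ?v) * norm (P ?v {h, k}) = norm (a k (k # ?v) + a k ?v)"
    using a_edge[OF w] P_single[OF wv(2,4), of ?v] by (simp add: norm_mult)
  also have "\<dots> \<le> 2 * norm (a k ?v)"
    using norm_triangle_ineq[of "a k (k # ?v)" "a k ?v"] bad by (simp add: bad_Cons)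
  finally have le: "norm (a h ?v) * norm (P ?v {h, k}) \<le> 2 * norm (a k ?v)" .
  have "norm (a h ?v) * K \<le> norm (a h ?v) * norm (P ?v {h, k})"
    using K by (intro mult_left_mono) auto
  then show *: "K * norm (a h ?v) \<le> 2 * norm (a k ?v)" using le by (simp add: mult.commute)
  show "bad ?v"
  proof (rule ccontr)
    assume "\<not> bad ?v"
    then have nb: "norm (a h w) \<le> norm (a h ?v)" by (simp add: bad_Cons)
    have "norm (a k ?v) * norm (P ?v {h, k}) = norm (a h ?v + a h w)"
      using a_edge[OF wv(1)] P_Cons[OF wv(1), of "{h}"] P_single[of k h ?v] wv
      by (simp add: norm_mult insert_commute)
    also have "\<dots> \<le> 2 * norm (a h ?v)"
      using norm_triangle_ineq[of "a h ?v" "a h w"] nb by simp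
    finally have le': "norm (a k ?v) * norm (P ?v {h, k}) \<le> 2 * norm (a h ?v)" .
    have "norm (a k ?v) * K \<le> norm (a k ?v) * norm (P ?v {h, k})"
      using K by (intro mult_left_mono) auto
    with le' have **: "K * norm (a k ?v) \<le> 2 * norm (a h ?v)" by (simp add: mult.commute)
    \<comment> \<open>Since \<open>K > 2\<close>, the inequalities \<open>*\<close> and
      \<open>**\<close> make each of two positive norms strictly smaller than the other.\<close>
    have "norm (a h ?v) > 0" "norm (a k ?v) > 0" using a_nonzero wv by auto
    moreover from this have "2 * norm (a h ?v) < K * norm (a h ?v)" "2 * norm (a k ?v) < K * norm (a k ?v)"
      using K by simp_all
    ultimately show False using * ** by linarith
  qed
qed

section \<open>Values along a ray and their growth\<close>

definition ray_seq :: "nat \<Rightarrow> nat \<Rightarrow> nat list \<Rightarrow> nat \<Rightarrow> complex" where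
  "ray_seq x y u m = a (alt x y (Suc m)) (ray x y u m)"

text \<open>The stripping condition puts \<open>u\<close> at the vertex of the geodesic closest to
  the root, so that the ray leads away from the root.\<close>

definition start :: "nat \<Rightarrow> nat \<Rightarrow> nat list \<Rightarrow> bool" where
  "start x y u \<longleftrightarrow> word u \<and> x \<in> {1..n} \<and> y \<in> {1..n} \<and> x \<noteq> y \<and> dropWhile (\<lambda>k. k \<in> {x, y}) u = u"

context
  fixes x y u assumes st: "start x y u"
begin

lemma word_ray': "word (ray x y u m)"
  using st by (intro word_ray) (simp_all add: start_def)

lemma alt_label: "alt x y m \<in> {1..n}"
  using st alt_in[of x y m] by (auto simp: start_def)

lemma alt_neq: "alt x y (Suc m) \<noteq> alt x y m"
  using st alt_Suc_neq by (simp add: start_def)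

lemma P_ray: "{x, y} \<subseteq> I \<Longrightarrow> P (ray x y u m) I = P u I"
proof (induction m)
  case (Suc m)
  have "P (ray x y u (Suc m)) I = P (ray x y u m) I"
    unfolding ray.simps using word_ray'[of "Suc m"] alt_in[of x y "Suc m"] Suc.prems
    by (intro P_Cons) auto
  with Suc show ?case by simp
qed simp

text \<open>At the \<open>m\<close>-th vertex the two values that change along the ray are thus
  terms \<open>m\<close> and \<open>m + 1\<close>. Terms \<open>m\<close> and \<open>m + 2\<close>
  are the values at the two ends of the next edge, so the edge relation becomes the recurrence
  \<open>ray_seq_rec\<close>.\<close>

lemma ray_seq_Suc: "ray_seq x y u (Suc m) = a (alt x y m) (ray x y u m)"
  unfolding ray_seq_def alt_Suc_Suc ray.simps(2)
  by (rule a_Cons) (use word_ray'[of "Suc m"] alt_neq[of m] in auto)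

lemma ray_seq_rec:
  "ray_seq x y u (Suc (Suc m)) = P u {x, y} * ray_seq x y u (Suc m) - ray_seq x y u m"
proof -
  have "ray_seq x y u (Suc (Suc m)) + ray_seq x y u m = P (ray x y u m) {alt x y (Suc m)}"
    using a_edge[of "alt x y (Suc m)" "ray x y u m"] word_ray'[of "Suc m"]
    unfolding ray_seq_Suc by (simp add: ray_seq_def)
  also have "\<dots> = a (alt x y m) (ray x y u m) * P (ray x y u m) {alt x y m, alt x y (Suc m)}"
    using alt_neq[of m] by (intro P_single alt_label) auto
  also have "\<dots> = ray_seq x y u (Suc m) * P u {x, y}"
    using alt_doubleton[of x y m] P_ray[of "{x, y}" m] by (simp add: ray_seq_Suc insert_commute)
  finally show ?thesis by (simp add: algebra_simps)
qed

text \<open>Of the factors at the \<open>m\<close>-th vertex only the one at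
  \<open>alt x y m\<close> varies along the ray; those at labels outside \<open>{x, y, j}\<close>
  are constant there.\<close>

lemma P_ray_crossing:
  assumes "j \<notin> {x, y}"
  shows "P (ray x y u m) {alt x y (Suc m), j} = ray_seq x y u (Suc m) * P u {x, y, j}"
proof -
  have "alt x y m \<noteq> j" using alt_in[of x y m] assms by metis
  then have notin: "alt x y m \<notin> {alt x y (Suc m), j}"
    using not_sym[OF alt_neq[of m]] by simp
  have "{alt x y m, alt x y (Suc m), j} = {x, y, j}"
    using alt_doubleton[of x y m] by blast
  then have "P (ray x y u m) {alt x y m, alt x y (Suc m), j} = P u {x, y, j}"
    using P_ray[of "{x, y, j}" m] by simp
  then show ?thesis unfolding P_split[OF alt_label notin] ray_seq_Suc by metis
qed

text \<open>The shift to \<open>Suc m\<close> gives the word the head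
  \<open>alt x y (Suc m)\<close>, which lies outside the crossing pair; so the word is already
  stripped, as \<open>exceptional\<close> demands.\<close>

lemma ray_exceptional:
  assumes "j \<in> {1..n}" "j \<notin> {x, y}" "norm (ray_seq x y u (Suc (Suc m)) * P u {x, y, j}) \<le> K"
  shows "(ray x y u (Suc m), {alt x y m, j}) \<in> exceptional K"
proof -
  have neq: "alt x y l \<noteq> j" for l using assms(2) alt_in[of x y l] by metis
  have "{alt x y m, j} \<in> pairs"
    unfolding pairs_def using alt_label[of m] assms(1) neq[of m] by blast
  moreover have "alt x y (Suc m) \<notin> {alt x y m, j}"
    using alt_neq[of m] neq[of "Suc m"] by simp
  moreover have "norm (P (ray x y u (Suc m)) {alt x y m, j}) \<le> K"
    using P_ray_crossing[OF assms(2), of "Suc m"] assms(3) unfolding alt_Suc_Suc by metis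
  ultimately show ?thesis
    using word_ray'[of "Suc m"] by (simp add: exceptional_def)
qed

text \<open>Geodesics crossing the ray at different vertices are distinct, so all but finitely many
  have norm above \<open>K\<close>. Dividing by the constant factor \<open>Q\<close> gives the lower
  bound for \<open>linear_recurrence_growth\<close>; (B1) gives its condition on
  \<open>p\<close>.\<close>

lemma ray_growth:
  assumes "K > 2" "finite (exceptional K)"
  obtains c where "c > 0"
    "\<forall>\<^sub>F m in sequentially. ln (norm (ray_seq x y u m)) \<ge> c * real m \<and>
      norm (ray_seq x y u (Suc (Suc m))) \<ge> norm (ray_seq x y u m)"
proof -
  have xy: "x \<in> {1..n}" "y \<in> {1..n}" using st by (simp_all add: start_def)
  obtain j where j: "j \<in> {1..n}" "j \<notin> {x, y}" using label_avoiding[OF xy] .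
  define Q where "Q = norm (P u {x, y, j})"
  have Q: "Q > 0" using P_nonzero st by (simp add: Q_def start_def)
  let ?S = "{m. norm (ray_seq x y u (Suc (Suc m)) * P u {x, y, j}) \<le> K}"
  have "(\<lambda>m. ray x y u (Suc m)) ` ?S \<subseteq> fst ` exceptional K"
    using ray_exceptional[OF j] by force
  then have "finite ((\<lambda>m. ray x y u (Suc m)) ` ?S)"
    using assms(2) finite_subset by blast
  moreover have "inj_on (\<lambda>m. ray x y u (Suc m)) ?S"
    by (rule inj_onI) (metis add_left_cancel length_ray nat.inject)
  ultimately have "finite ?S" by (rule finite_imageD)
  then have "\<forall>\<^sub>F m in sequentially. m \<notin> ?S"
    by (simp add: eventually_cofinite flip: cofinite_eq_sequentially)
  then have "\<forall>\<^sub>F m in sequentially. norm (ray_seq x y u (m + 2)) \<ge> K / Q"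
    by eventually_elim (use Q in \<open>simp add: norm_mult Q_def field_simps\<close>)
  then have ev: "\<forall>\<^sub>F m in sequentially. norm (ray_seq x y u m) \<ge> K / Q"
    by (subst (asm) eventually_sequentially_seg)
  have B: "P u {x, y} \<notin> complex_of_real ` {-2..2}"
    using st by (intro B1) (simp_all add: start_def)
  have "K / Q > 0" using assms(1) Q by simp
  from linear_recurrence_growth[OF ray_seq_rec B this ev] that show ?thesis by blast
qed

lemma finite_bad_ray:
  assumes "K > 2" "finite (exceptional K)"
  shows "finite {ray x y u m |m. bad (ray x y u m)}"
proof -
  obtain c where "\<forall>\<^sub>F m in sequentially. ln (norm (ray_seq x y u m)) \<ge> c * real m \<and>
      norm (ray_seq x y u (Suc (Suc m))) \<ge> norm (ray_seq x y u m)"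
    by (rule ray_growth[OF assms])
  then obtain N where N: "\<And>m. m \<ge> N \<Longrightarrow> norm (ray_seq x y u (Suc (Suc m))) \<ge> norm (ray_seq x y u m)"
    by (auto simp: eventually_sequentially)
  \<comment> \<open>Badness of this word compares term \<open>m + 2\<close> with term
    \<open>m\<close>, so two-step monotonicity decides it.\<close>
  have "\<not> bad (ray x y u (Suc m))" if "m \<ge> N" for m
    using N[OF that] unfolding ray_seq_Suc[of "Suc m"] unfolding ray_seq_def ray.simps bad_Cons not_less .
  then have "m \<le> N" if "bad (ray x y u m)" for m
    using that by (metis Suc_le_mono linorder_le_cases not0_implies_Suc not_less_eq_eq zero_le)
  then have "{ray x y u m |m. bad (ray x y u m)} \<subseteq> ray x y u ` {..N}" by blast
  then show ?thesis using finite_surj by blast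
qed

end

end

section \<open>Finiteness of the bad words\<close>

locale bowditch_bound = bowditch +
  fixes K :: real
  assumes K2: "K > 2" and fin: "finite (exceptional K)"
begin

lemma exceptional_start:
  assumes "word w" "i \<in> {1..n}" "j \<in> {1..n}" "i \<noteq> j" "norm (P w {i, j}) \<le> K"
  shows "(dropWhile (\<lambda>l. l \<in> {i, j}) w, {i, j}) \<in> exceptional K"
proof -
  have "{i, j} \<in> pairs" using assms(2-4) unfolding pairs_def by blast
  moreover have "norm (P (dropWhile (\<lambda>l. l \<in> {i, j}) w) {i, j}) \<le> K"
    using assms(5) unfolding P_dropWhile[OF assms(1)] .
  ultimately show ?thesis
    unfolding exceptional_def using word_dropWhile[OF assms(1)] dropWhile_idem by blast
qed

text \<open>Places a step along an exceptional geodesic on one of the finitely many rays collected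
  in \<open>rays\<close>.\<close>

lemma exceptional_ray:
  assumes "word (k # w)" "i \<in> {1..n}" "j \<in> {1..n}" "i \<noteq> j" "k \<in> {i, j}" "norm (P w {i, j}) \<le> K"
  obtains x y u m where "(u, {x, y}) \<in> exceptional K" "start x y u" "{x, y} = {i, j}"
    "w = ray x y u m" "k = alt x y (Suc m)"
proof -
  let ?u = "dropWhile (\<lambda>l. l \<in> {i, j}) w"
  have w: "word w" using assms(1) by (simp add: word_Cons)
  obtain x y m where *: "{x, y} = {i, j}" "w = ray x y ?u m" "k = alt x y (Suc m)"
    using word_eq_ray[OF assms(1,5,4)] by (elim exE conjE)
  have "(?u, {x, y}) \<in> exceptional K"
    unfolding *(1) by (rule exceptional_start[OF w assms(2-4,6)])
  moreover have "x \<in> {1..n}" "y \<in> {1..n}" "x \<noteq> y"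
    using *(1) assms(2-4) unfolding doubleton_eq_iff by blast+
  then have "start x y ?u"
    unfolding start_def *(1) using word_dropWhile[OF w] dropWhile_idem by blast
  ultimately show ?thesis using that * by blast
qed

definition rays :: "(nat list \<times> nat \<times> nat) set" where
  "rays = {(u, x, y). (u, {x, y}) \<in> exceptional K \<and> start x y u}"

lemma finite_rays: "finite rays"
proof (rule finite_subset)
  show "rays \<subseteq> fst ` exceptional K \<times> {1..n} \<times> {1..n}"
  proof (clarify, unfold mem_Sigma_iff)
    fix u x y assume "(u, x, y) \<in> rays"
    then have "(u, {x, y}) \<in> exceptional K" "start x y u" by (simp_all add: rays_def)
    then show "u \<in> fst ` exceptional K \<and> x \<in> {1..n} \<and> y \<in> {1..n}"
      unfolding start_def by (metis fst_conv imageI)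
  qed
qed (use fin in simp)

text \<open>These are the bad words of length at least two to which \<open>bad_parent\<close> does
  not apply. Each lies on a ray along an exceptional geodesic; there are finitely many such rays,
  and each carries finitely many bad words.\<close>

lemma finite_bad_exceptional:
  "finite {k # h # w |k h w. word (k # h # w) \<and> bad (k # h # w) \<and> norm (P (h # w) {h, k}) \<le> K}"
    (is "finite ?E")
proof (rule finite_subset)
  show "?E \<subseteq> (\<Union>(u, x, y)\<in>rays. {ray x y u m |m. bad (ray x y u m)})"
  proof
    fix z assume "z \<in> ?E"
    then obtain k h w where z: "z = k # h # w" "word (k # h # w)" "bad (k # h # w)"
      "norm (P (h # w) {h, k}) \<le> K" by blast
    have hk: "h \<in> {1..n}" "k \<in> {1..n}" "h \<noteq> k" using z(2) by (auto simp: word_Cons)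
    obtain x y u m where r: "(u, {x, y}) \<in> exceptional K" "start x y u"
      "h # w = ray x y u m" "k = alt x y (Suc m)"
      by (rule exceptional_ray[OF z(2) hk _ z(4)]) blast+
    have "z = ray x y u (Suc m)" unfolding z(1) r(3,4) by simp
    moreover have "bad z" using z(1,3) by simp
    ultimately have "z \<in> {ray x y u m |m. bad (ray x y u m)}" by blast
    moreover have "(u, x, y) \<in> rays" using r(1,2) by (simp add: rays_def)
    ultimately show "z \<in> (\<Union>(u, x, y)\<in>rays. {ray x y u m |m. bad (ray x y u m)})"
      by (intro UN_I[of "(u, x, y)"]) simp_all
  qed
  show "finite (\<Union>(u, x, y)\<in>rays. {ray x y u m |m. bad (ray x y u m)})"
  proof (rule finite_UN_I[OF finite_rays])
    fix r assume "r \<in> rays"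
    moreover obtain u x y where "r = (u, x, y)" by (rule prod_cases3)
    ultimately have "start x y u" by (simp add: rays_def)
    from finite_bad_ray[OF this K2 fin]
    show "finite (case r of (u, x, y) \<Rightarrow> {ray x y u m |m. bad (ray x y u m)})"
      unfolding \<open>r = _\<close> case_prod_conv .
  qed
qed

text \<open>Values of norm at most \<open>K\<close> occur only on the finitely many exceptional
  geodesics, and there they are nonzero.\<close>

lemma P_lower_bound:
  "\<exists>\<epsilon>>0. \<forall>w i j. word w \<longrightarrow> i \<in> {1..n} \<longrightarrow> j \<in> {1..n} \<longrightarrow> i \<noteq> j \<longrightarrow> norm (P w {i, j}) \<ge> \<epsilon>"
proof -
  have "\<exists>c>0. \<forall>s\<in>exceptional K. c \<le> norm (P (fst s) (snd s))"
  proof (rule finite_common_positive[OF fin])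
    fix s assume "s \<in> exceptional K"
    then have "norm (P (fst s) (snd s)) > 0" by (auto simp: exceptional_def P_nonzero)
    then show "\<exists>c>0. c \<le> norm (P (fst s) (snd s))" by blast
  qed auto
  then obtain c where c: "c > 0" "\<And>s. s \<in> exceptional K \<Longrightarrow> c \<le> norm (P (fst s) (snd s))" by blast
  have "norm (P w {i, j}) \<ge> min c K"
    if "word w" "i \<in> {1..n}" "j \<in> {1..n}" "i \<noteq> j" for w i j
  proof (cases "norm (P w {i, j}) \<le> K")
    case True
    have "c \<le> norm (P w {i, j})"
      using c(2)[OF exceptional_start[OF that True]] unfolding fst_conv snd_conv P_dropWhile[OF that(1)] .
    then show ?thesis by simp
  qed simp
  moreover have "min c K > 0" using c(1) K2 by simp
  ultimately show ?thesis by blast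
qed

text \<open>Along a chain of bad words whose steps lie on nonexceptional geodesics, the sum \<open>U\<close> of the norms
  of the values at all labels but the head drops by a fixed amount at each step; as \<open>U \<ge> 0\<close>, such
  chains are short.\<close>

lemma finite_bad: "finite {w. word w \<and> bad w}"
proof -
  obtain N0 where N0: "\<And>w. w \<in> {k # h # w |k h w. word (k # h # w) \<and> bad (k # h # w) \<and>
      norm (P (h # w) {h, k}) \<le> K} \<Longrightarrow> length w \<le> N0"
    using finite_imageI[OF finite_bad_exceptional, of length] by (auto simp: finite_nat_set_iff_bounded_le)
  \<comment> \<open>\<open>Suc\<close> keeps \<open>N\<close> positive, so that every word longer
    than \<open>N\<close> has at least two letters.\<close>
  define N where "N = Suc N0"
  have nonexc: "norm (P (h # w) {h, k}) > K"
    if "word (k # h # w)" "bad (k # h # w)" "length (h # w) \<ge> N" for k h w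
    using N0[of "k # h # w"] that by (fastforce simp: N_def not_le)
  have "finite ((\<lambda>(w, k). norm (a k w)) ` ({w. word w \<and> length w \<le> N} \<times> {1..n}))"
    by (intro finite_imageI finite_cartesian_product finite_words) simp
  then obtain M0 where M0: "\<And>w k. word w \<Longrightarrow> length w = N \<Longrightarrow> k \<in> {1..n} \<Longrightarrow> norm (a k w) \<le> M0"
    using bdd_above_finite unfolding bdd_above_def by fastforce
  define M where "M = max 1 M0"
  obtain \<epsilon> where \<epsilon>: "\<epsilon> > 0"
    "\<And>w i j. word w \<Longrightarrow> i \<in> {1..n} \<Longrightarrow> j \<in> {1..n} \<Longrightarrow> i \<noteq> j \<Longrightarrow> norm (P w {i, j}) \<ge> \<epsilon>"
    using P_lower_bound by blast
  have M1: "M \<ge> 1" by (simp add: M_def)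
  \<comment> \<open>\<open>a h w\<close> is a factor of a value of norm at least
    \<open>\<epsilon>\<close>; the other factors, at most \<open>n\<close> of them, have norm at
    most \<open>M\<close>.\<close>
  have low: "norm (a h w) \<ge> \<epsilon> / M ^ n"
    if hw: "word w" "h \<in> {1..n}" "\<forall>k\<in>{1..n}. norm (a k w) \<le> M" for w h
  proof -
    obtain i j where ij: "i \<in> {1..n}" "j \<in> {1..n}" "i \<noteq> j" "h \<notin> {i, j}"
      using pair_avoiding[OF hw(2)] .
    have "norm (P w (insert h {i, j})) \<le> (\<Prod>k\<in>{1..n} - insert h {i, j}. M)"
      unfolding P_def prod_norm[symmetric] by (intro prod_mono) (use hw(3) in auto)
    also have "\<dots> \<le> M ^ n"
      using M1 card_mono[of "{1..n}" "{1..n} - insert h {i, j}"] by (simp add: power_increasing)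
    finally have "norm (a h w) * norm (P w (insert h {i, j})) \<le> norm (a h w) * M ^ n"
      by (intro mult_left_mono) auto
    moreover have "\<epsilon> \<le> norm (a h w) * norm (P w (insert h {i, j}))"
      using \<epsilon>(2)[OF hw(1) ij(1-3)] unfolding P_split[OF hw(2) ij(4)] norm_mult .
    ultimately have "\<epsilon> \<le> norm (a h w) * M ^ n" by linarith
    then show ?thesis using M1 by (simp add: divide_le_eq)
  qed
  \<comment> \<open>The amount by which \<open>U\<close> drops at each step:
    \<open>bad_parent\<close> gives a drop of at least \<open>K / 2 - 1\<close> times the norm of
    the value at \<open>h\<close>, and \<open>low\<close> bounds that norm from below.\<close>
  define c where "c = (K / 2 - 1) * (\<epsilon> / M ^ n)"
  have c: "c > 0" using K2 \<epsilon>(1) M1 by (simp add: c_def)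
  \<comment> \<open>With the head label omitted, a step from \<open>h # s\<close> to
    \<open>k # h # s\<close> brings the value at \<open>h\<close> into the sum and takes the one at
    \<open>k\<close> out.\<close>
  define U where "U w = (\<Sum>k\<in>{1..n} - {hd w}. norm (a k w))" for w
  have U: "(\<forall>k\<in>{1..n}. norm (a k w) \<le> M) \<and> U w \<le> n * M - d * c"
    if "word w" "bad w \<or> d = 0" "length w = N + d" for w d
    using that
  proof (induction d arbitrary: w)
    case 0
    have le: "norm (a k w) \<le> M" if "k \<in> {1..n}" for k
      using M0[of w k] 0 that by (simp add: M_def le_max_iff_disj)
    then have "U w \<le> (\<Sum>k\<in>{1..n} - {hd w}. M)" unfolding U_def by (intro sum_mono) auto
    also have "\<dots> \<le> (\<Sum>k\<in>{1..n}. M)" using M1 by (intro sum_mono2) auto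
    finally show ?case using le by simp
  next
    case (Suc d)
    then obtain k h s where w: "w = k # h # s"
      by (cases w; cases "tl w") (auto simp: N_def)
    have ks: "word (h # s)" "k \<in> {1..n}" "h \<in> {1..n}" "h \<noteq> k"
      using Suc.prems w by (auto simp: word_Cons)
    have bw: "bad (k # h # s)" "word (k # h # s)" using Suc.prems w by auto
    have ne: "norm (P (h # s) {h, k}) > K"
      using nonexc[OF bw(2,1)] Suc.prems(3) w by simp
    note bp = bad_parent[OF bw(2,1) K2 ne]
    have IH: "\<forall>k\<in>{1..n}. norm (a k (h # s)) \<le> M" "U (h # s) \<le> n * M - d * c"
      using Suc.IH[OF ks(1)] bp(1) Suc.prems(3) w by auto
    have other: "a j w = a j (h # s)" if "j \<noteq> k" for j
      using a_Cons[OF bw(2) that] w by simp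
    have "norm (a j w) \<le> M" if j: "j \<in> {1..n}" for j
    proof (cases "j = k")
      case True
      \<comment> \<open>Only the value at \<open>k\<close> changes, and badness makes it smaller in
        norm, so the bound \<open>M\<close> persists.\<close>
      then show ?thesis using bw(1) IH(1) j w by (force simp: bad_Cons)
    next
      case False
      then show ?thesis using other IH(1) j by simp
    qed
    moreover have "U w \<le> n * M - Suc d * c"
    proof -
      let ?f = "\<lambda>j. norm (a j (h # s))"
      have "U w = sum ?f ({1..n} - {k})"
        unfolding U_def using other w by (intro sum.cong) auto
      also have "\<dots> = sum ?f {1..n} - ?f k" using ks by (simp add: sum_diff1)
      also have "sum ?f {1..n} = U (h # s) + ?f h" using ks by (simp add: U_def sum_diff1)
      finally have "U w = U (h # s) + ?f h - ?f k" .
      moreover have "?f h - ?f k \<le> - (K / 2 - 1) * ?f h" using bp(2) by (simp add: algebra_simps)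
      moreover have "(K / 2 - 1) * ?f h \<ge> c"
        unfolding c_def using K2 low[OF ks(1,3) IH(1)] by (intro mult_left_mono) auto
      ultimately show ?thesis using IH(2) by (simp add: algebra_simps)
    qed
    ultimately show ?case by blast
  qed
  define L where "L = nat \<lceil>n * M / c\<rceil>"
  have "length w \<le> N + L" if "word w" "bad w" for w
  proof (cases "length w \<le> N")
    case False
    then obtain d where d: "length w = N + d" by (metis le_iff_add nat_le_linear)
    have "0 \<le> U w" by (simp add: U_def sum_nonneg)
    then have "d * c \<le> n * M" using U[OF that(1) _ d] that(2) by simp
    then have "real d \<le> n * M / c" using c by (simp add: pos_le_divide_eq)
    then have "d \<le> L" unfolding L_def by linarith
    then show ?thesis using d by simp
  qed simp
  then have "{w. word w \<and> bad w} \<subseteq> {w. word w \<and> length w \<le> N + L}" by blast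
  then show ?thesis using finite_words finite_subset by blast
qed

section \<open>Propagating the Fibonacci bound\<close>

definition fib_bound :: "real \<Rightarrow> nat list \<Rightarrow> nat \<Rightarrow> nat \<Rightarrow> bool" where
  "fib_bound c w i j \<longleftrightarrow>
    (norm (P w {i, j}) > K \<longrightarrow> ln (norm (P w {i, j}) / 2) \<ge> c * real (fib_word w i j))"

lemma fib_bound_mono: "fib_bound c w i j \<Longrightarrow> c' \<le> c \<Longrightarrow> fib_bound c' w i j"
  unfolding fib_bound_def by (meson mult_right_mono of_nat_0_le_iff order_trans)

lemma fib_bound_commute: "fib_bound c w i j \<longleftrightarrow> fib_bound c w j i"
  unfolding fib_bound_def by (simp only: insert_commute fib_word_commute[of w i j])

lemma fib_bound_single: "\<exists>c>0. fib_bound c w i j"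
proof (cases "norm (P w {i, j}) > K")
  case True
  let ?f = "real (fib_word w i j)"
  have "?f > 0" using fib_word_pos by simp
  moreover have "ln (norm (P w {i, j}) / 2) > 0" using True K2 by (intro ln_gt_zero) simp
  ultimately show ?thesis
    by (intro exI[of _ "ln (norm (P w {i, j}) / 2) / ?f"]) (simp add: fib_bound_def)
qed (auto simp: fib_bound_def intro: exI[of _ 1])

text \<open>On geodesics crossing a ray both sides are under control: by \<open>ray_growth\<close>
  the logarithm grows at least linearly in \<open>m\<close>, and by
  \<open>fib_word_ray_crossing\<close> the Fibonacci value is exactly linear. The finitely many
  small \<open>m\<close> only require a smaller constant.\<close>

lemma fib_bound_ray:
  assumes st: "start x y u" and j: "j \<notin> {x, y}"
  shows "\<exists>c>0. \<forall>m. fib_bound c (ray x y u m) (alt x y (Suc m)) j"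
proof -
  define Q where "Q = norm (P u {x, y, j})"
  have Q: "Q > 0" using P_nonzero st by (simp add: Q_def start_def)
  define f g where "f = real (fib_word u x y)" and "g = real (fib_word u x j)"
  have fg: "f > 0" "g > 0" using fib_word_pos by (simp_all add: f_def g_def)
  obtain c where c: "c > 0" "\<forall>\<^sub>F m in sequentially. ln (norm (ray_seq x y u m)) \<ge> c * real m \<and>
      norm (ray_seq x y u (Suc (Suc m))) \<ge> norm (ray_seq x y u m)"
    by (rule ray_growth[OF st K2 fin])
  have "filterlim (\<lambda>m. c / 2 * real m) at_top sequentially"
    using c by (intro filterlim_tendsto_pos_mult_at_top[OF tendsto_const _ filterlim_real_sequentially]) simp
  then have "\<forall>\<^sub>F m in sequentially. c / 2 * real m \<ge> - ln (Q / 2)"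
    unfolding filterlim_at_top by (rule spec)
  with c(2) have "\<forall>\<^sub>F m in sequentially. ln (norm (ray_seq x y u m)) \<ge> c * real m \<and> c / 2 * real m \<ge> - ln (Q / 2)"
    by eventually_elim simp
  then obtain N where N: "\<And>m. m \<ge> N \<Longrightarrow> ln (norm (ray_seq x y u m)) \<ge> c * real m"
      "\<And>m. m \<ge> N \<Longrightarrow> c / 2 * real m \<ge> - ln (Q / 2)"
    unfolding eventually_sequentially by blast
  \<comment> \<open>The Fibonacci value is at most \<open>(f + g) * (m + 1)\<close>. Half of the
    rate \<open>c\<close> pays for it, the other half for the constant
    \<open>ln (Q / 2)\<close>.\<close>
  define c' where "c' = c / 2 / (f + g)"
  have large: "fib_bound c' (ray x y u m) (alt x y (Suc m)) j" if "m \<ge> N" for m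
  proof -
    let ?b = "norm (ray_seq x y u (Suc m))"
    have b0: "?b > 0"
      unfolding ray_seq_Suc[OF st] using a_nonzero[OF word_ray'[OF st] alt_label[OF st]] by simp
    have "real (fib_word (ray x y u m) (alt x y (Suc m)) j) = g + m * f"
      using fib_word_ray_crossing[of x y j u m] st j by (simp add: f_def g_def start_def)
    also have "\<dots> \<le> (f + g) * real (Suc m)" using fg by (simp add: algebra_simps)
    finally have "c' * real (fib_word (ray x y u m) (alt x y (Suc m)) j) \<le> c' * ((f + g) * real (Suc m))"
      using c fg by (intro mult_left_mono) (auto simp: c'_def)
    also have "\<dots> = c' * (f + g) * real (Suc m)" by (rule mult.assoc[symmetric])
    also have "c' * (f + g) = c / 2"
      unfolding c'_def by (rule nonzero_eq_divide_eq[THEN iffD1, OF _ refl]) (use fg in simp)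
    also have "c / 2 * real (Suc m) \<le> ln ?b + ln (Q / 2)" using N[of "Suc m"] that by (simp add: algebra_simps)
    also have "\<dots> = ln (?b * (Q / 2))" using b0 Q by (intro ln_mult_pos[symmetric]) auto
    also have "?b * (Q / 2) = norm (P (ray x y u m) {alt x y (Suc m), j}) / 2"
      unfolding P_ray_crossing[OF st j] norm_mult Q_def by simp
    finally show ?thesis by (simp add: fib_bound_def)
  qed
  have "\<exists>c>0. \<forall>m\<in>{..<N}. fib_bound c (ray x y u m) (alt x y (Suc m)) j"
    by (rule finite_common_positive) (auto intro: fib_bound_single fib_bound_mono)
  then obtain c'' where "c'' > 0" "\<forall>m<N. fib_bound c'' (ray x y u m) (alt x y (Suc m)) j" by auto
  moreover have "c' > 0" using c fg by (simp add: c'_def)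
  moreover have "fib_bound (min c' c'') (ray x y u m) (alt x y (Suc m)) j" for m
    using large[of m] calculation(2) by (cases "m < N") (auto intro: fib_bound_mono)
  ultimately show ?thesis by (intro exI[of _ "min c' c''"]) simp
qed

text \<open>Treats the case where the superadditive step fails because the geodesic with labels
  \<open>{i, h}\<close> is exceptional. The geodesic with labels \<open>{i, j}\<close> then crosses
  a ray along it, so \<open>fib_bound_ray\<close> applies; finitely many rays and labels
  \<open>j\<close> allow one constant.\<close>

lemma fib_bound_exceptional:
  "\<exists>c>0. \<forall>h w i j. word (h # w) \<longrightarrow> i \<in> {1..n} \<longrightarrow> j \<in> {1..n} \<longrightarrow> i \<noteq> j \<longrightarrow> h \<notin> {i, j} \<longrightarrow>
    norm (P (h # w) {i, h}) \<le> K \<longrightarrow> fib_bound c (h # w) i j"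
proof -
  define Q where "Q c s \<longleftrightarrow> (\<forall>u x y j m. s = ((u, x, y), j) \<longrightarrow> j \<notin> {x, y} \<longrightarrow>
    fib_bound c (ray x y u m) (alt x y (Suc m)) j)" for c s
  have "\<exists>c>0. Q c s" if s: "s \<in> rays \<times> {1..n}" for s
  proof -
    obtain u x y j where s': "s = ((u, x, y), j)" by (metis prod.collapse)
    with s have st: "start x y u" by (simp add: rays_def)
    show ?thesis
    proof (cases "j \<in> {x, y}")
      case True
      then have "Q 1 s" unfolding Q_def s' by blast
      then show ?thesis using zero_less_one by blast
    next
      case False
      obtain c where c: "c > 0" "\<forall>m. fib_bound c (ray x y u m) (alt x y (Suc m)) j"
        using fib_bound_ray[OF st False] by (elim exE conjE)
      then have "Q c s" unfolding Q_def s' by blast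
      with c(1) show ?thesis by blast
    qed
  qed
  moreover have "Q c' s" if "Q c s" "c' \<le> c" for c c' s
    using that(1) fib_bound_mono[OF _ that(2)] unfolding Q_def by blast
  ultimately have "\<exists>c>0. \<forall>s\<in>rays \<times> {1..n}. Q c s"
    using finite_rays by (intro finite_common_positive) simp_all
  then obtain c2 where c2': "c2 > 0" "\<forall>s\<in>rays \<times> {1..n}. Q c2 s" by (elim exE conjE)
  have c2: "fib_bound c2 (ray x y u m) (alt x y (Suc m)) j"
    if "(u, x, y) \<in> rays" "j \<in> {1..n}" "j \<notin> {x, y}" for u x y j m
  proof -
    have "((u, x, y), j) \<in> rays \<times> {1..n}" using that(1,2) by (rule SigmaI)
    with c2'(2) have "Q c2 ((u, x, y), j)" by (rule bspec)
    then show ?thesis using that(3) unfolding Q_def by blast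
  qed
  have "fib_bound c2 (h # w) i j"
    if prems: "word (h # w)" "i \<in> {1..n}" "j \<in> {1..n}" "i \<noteq> j" "h \<notin> {i, j}"
      "norm (P (h # w) {i, h}) \<le> K" for h w i j
  proof -
    have h: "h \<in> {1..n}" "i \<noteq> h" "j \<notin> {i, h}"
      using prems(1)[unfolded word_Cons] prems(4,5) by blast+
    have le: "h \<in> {i, h}" "norm (P w {i, h}) \<le> K" using prems(6) P_Cons[OF prems(1), of "{i, h}"] by simp_all
    obtain x y u m where r: "(u, {x, y}) \<in> exceptional K" "start x y u" "{x, y} = {i, h}"
      "w = ray x y u m" "h = alt x y (Suc m)"
      by (rule exceptional_ray[OF prems(1,2) h(1,2) le])
    \<comment> \<open>\<open>i\<close> is the label with which the ray continues after
      \<open>h\<close>, so \<open>{i, j}\<close> is a crossing pair as in \<open>c2\<close>.\<close>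
    have "i \<in> {alt x y (Suc m), alt x y m}" unfolding alt_doubleton r(3) by simp
    then have i: "i = alt x y (Suc (Suc m))" 
      unfolding alt_Suc_Suc using h(2) r(5) by blast
    have w: "h # w = ray x y u (Suc m)" by (simp only: r(4,5) ray.simps)
    have "(u, x, y) \<in> rays" using r(1,2) by (simp add: rays_def)
    moreover have "j \<notin> {x, y}" unfolding r(3) by (rule h(3))
    ultimately show "fib_bound c2 (h # w) i j" unfolding w i by (intro c2 prems(3))
  qed
  with c2'(1) show ?thesis by blast
qed

text \<open>Let \<open>q\<close> be the norm of the product over the labels outside
  \<open>{i, j, h}\<close>. The edge relation and the direction of the edge bound
  \<open>norm (a i ?v) * norm (a j ?v) * q\<close> by \<open>2 * norm (a h ?v)\<close>. A further
  factor \<open>q\<close> turns this into an inequality between the values on three geodesics;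
  halving each value absorbs the 2, and the logarithms then add up as the Fibonacci values
  do.\<close>

lemma fib_bound_step:
  assumes w: "word (h # w)" and nb: "\<not> bad (h # w)"
    and ij: "i \<in> {1..n}" "j \<in> {1..n}" "i \<noteq> j" and h: "h \<notin> {i, j}"
    and large: "norm (P (h # w) {i, h}) > K" "norm (P (h # w) {j, h}) > K"
    and bounds: "fib_bound c w i h" "fib_bound c w j h"
  shows "fib_bound c (h # w) i j"
proof -
  have hw: "word w" "h \<in> {1..n}" using w by (auto simp: word_Cons)
  let ?v = "h # w"
  have ne: "i \<noteq> h" "j \<noteq> h" using h by auto
  define q where "q = norm (P ?v {i, j, h})"
  have Pij: "norm (P ?v {i, j}) = norm (a h ?v) * q"
    unfolding P_split[OF hw(2) h] norm_mult q_def insert_commute[of h] ..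
  have Pih: "norm (P ?v {i, h}) = norm (a j ?v) * q"
    using P_split[OF ij(2), of "{i, h}" ?v] ne ij(3)
    unfolding q_def insert_commute[of i j] by (simp add: norm_mult)
  have Pjh: "norm (P ?v {j, h}) = norm (a i ?v) * q"
    using P_split[OF ij(1), of "{j, h}" ?v] ne ij(3)
    unfolding q_def by (simp add: norm_mult)
  have "P ?v {h} = a i ?v * P ?v {i, h}" by (rule P_single[OF ij(1) ne(1)])
  also have "norm \<dots> = norm (a i ?v) * norm (a j ?v) * q" by (simp add: norm_mult Pih)
  finally have "norm (a i ?v) * norm (a j ?v) * q = norm (a h ?v + a h w)"
    using a_edge[OF w] P_Cons[OF w, of "{h}"] by simp
  also have "\<dots> \<le> 2 * norm (a h ?v)"
    using norm_triangle_ineq[of "a h ?v" "a h w"] nb by (simp add: bad_Cons)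
  finally have "norm (a i ?v) * norm (a j ?v) * q * q \<le> 2 * norm (a h ?v) * q"
    by (intro mult_right_mono) (simp_all add: q_def)
  then have "norm (P ?v {i, h}) / 2 * (norm (P ?v {j, h}) / 2) \<le> norm (P ?v {i, j}) / 2"
    unfolding Pij Pih Pjh by (simp add: mult_ac)
  moreover have pos: "norm (P ?v {i, h}) / 2 > 0" "norm (P ?v {j, h}) / 2 > 0" using large K2 by auto
  ultimately have "ln (norm (P ?v {i, h}) / 2 * (norm (P ?v {j, h}) / 2)) \<le> ln (norm (P ?v {i, j}) / 2)"
    by (intro ln_mono) auto
  then have ln: "ln (norm (P ?v {i, h}) / 2) + ln (norm (P ?v {j, h}) / 2) \<le> ln (norm (P ?v {i, j}) / 2)"
    unfolding ln_mult_pos[OF pos] .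
  have "c * fib_word w i h \<le> ln (norm (P ?v {i, h}) / 2)"
    "c * fib_word w j h \<le> ln (norm (P ?v {j, h}) / 2)"
    using bounds large P_Cons[OF w, of "{i, h}"] P_Cons[OF w, of "{j, h}"]
    by (simp_all add: fib_bound_def)
  with ln show ?thesis using h by (simp add: fib_bound_def algebra_simps)
qed

text \<open>Induction on the word with one constant throughout: \<open>c1\<close> serves the root
  and the finitely many bad words, \<open>c2\<close> the neighbours of exceptional geodesics, and in
  all remaining cases the bound is inherited without loss.\<close>

lemma fib_bound_all:
  "\<exists>c>0. \<forall>w i j. word w \<longrightarrow> i \<in> {1..n} \<longrightarrow> j \<in> {1..n} \<longrightarrow> i \<noteq> j \<longrightarrow> fib_bound c w i j"
proof -
  let ?S = "insert [] {w. word w \<and> bad w} \<times> {1..n} \<times> {1..n}"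
  have "\<exists>c>0. \<forall>s\<in>?S. fib_bound c (fst s) (fst (snd s)) (snd (snd s))"
    by (rule finite_common_positive)
      (use finite_bad in simp, rule fib_bound_single, rule fib_bound_mono)
  then obtain c1 where c1': "c1 > 0" "\<And>s. s \<in> ?S \<Longrightarrow> fib_bound c1 (fst s) (fst (snd s)) (snd (snd s))"
    by blast
  have c1: "fib_bound c1 w i j" if "w = [] \<or> word w \<and> bad w" "i \<in> {1..n}" "j \<in> {1..n}" for w i j
    using c1'(2)[of "(w, i, j)"] that by simp
  obtain c2 where c2: "c2 > 0" "\<And>h w i j. word (h # w) \<Longrightarrow> i \<in> {1..n} \<Longrightarrow> j \<in> {1..n} \<Longrightarrow> i \<noteq> j \<Longrightarrow>
      h \<notin> {i, j} \<Longrightarrow> norm (P (h # w) {i, h}) \<le> K \<Longrightarrow> fib_bound c2 (h # w) i j"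
    using fib_bound_exceptional by blast
  define c where "c = min c1 c2"
  have exc: "fib_bound c (h # w) i j"
    if "word (h # w)" "i \<in> {1..n}" "j \<in> {1..n}" "i \<noteq> j" "h \<notin> {i, j}"
      "norm (P (h # w) {i, h}) \<le> K" for h w i j
    using c2(2)[OF that] by (rule fib_bound_mono) (simp add: c_def)
  have "fib_bound c w i j" if "word w" "i \<in> {1..n}" "j \<in> {1..n}" "i \<noteq> j" for w i j
    using that
  proof (induction w arbitrary: i j)
    case Nil
    have "fib_bound c1 [] i j" using Nil by (intro c1) simp_all
    then show ?case by (rule fib_bound_mono) (simp add: c_def)
  next
    case (Cons h w)
    have hw: "word w" "h \<in> {1..n}" using Cons.prems by (auto simp: word_Cons)
    consider "h \<in> {i, j}" | "bad (h # w)" | "h \<notin> {i, j}" "norm (P (h # w) {i, h}) \<le> K"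
      | "h \<notin> {i, j}" "norm (P (h # w) {j, h}) \<le> K"
      | "h \<notin> {i, j}" "norm (P (h # w) {i, h}) > K" "norm (P (h # w) {j, h}) > K" "\<not> bad (h # w)"
      by (meson not_le)
    then show ?case
    proof cases
      case 1
      then show ?thesis using Cons.IH[OF hw(1) Cons.prems(2-4)] P_Cons[OF Cons.prems(1) 1]
        by (simp add: fib_bound_def)
    next
      case 2
      have "fib_bound c1 (h # w) i j" using Cons.prems 2 by (intro c1) simp_all
      then show ?thesis by (rule fib_bound_mono) (simp add: c_def)
    next
      case 3
      then show ?thesis using exc Cons.prems by blast
    next
      case 4
      then have "h \<notin> {j, i}" by blast
      then show ?thesis
        using exc[OF Cons.prems(1,3,2) Cons.prems(4)[symmetric] _ 4(2)] fib_bound_commute by blast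
    next
      case 5
      have "i \<noteq> h" "j \<noteq> h" using 5(1) by auto
      then have "fib_bound c w i h" "fib_bound c w j h"
        using Cons.IH[OF hw(1)] Cons.prems(2,3) hw(2) by simp_all
      then show ?thesis by (rule fib_bound_step[OF Cons.prems(1) 5(4) Cons.prems(2-4) 5(1-3)])
    qed
  qed
  moreover have "c > 0" using c1' c2 by (simp add: c_def)
  ultimately show ?thesis by blast
qed

end

section \<open>Return from words to alternating geodesics\<close>

theorem proposition3p11:
  fixes n :: nat
    and \<Delta> :: "'v labelled_graph"
    and v0 :: 'v
    and \<phi> :: "'v set \<Rightarrow> complex"
  assumes "n \<ge> 3"
    and "labelled_regular_tree n \<Delta>"
    and "v0 \<in> verts \<Delta>"
    and "\<phi> \<in> bowditch_maps n \<Delta>"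
  shows "lower_fibonacci_bound n \<Delta> v0 (\<lambda>\<gamma>. log_plus (norm (hurwitz_ext n \<Delta> \<phi> \<gamma>)))"
proof -
  interpret bowditch n \<Delta> v0 \<phi> using assms by unfold_locales
  obtain K where K: "K > 2" "finite (exceptional K)"
    "finite {\<gamma> \<in> alt_geodesics n \<Delta>. norm (hurwitz_ext n \<Delta> \<phi> \<gamma>) \<le> K}"
    using finite_exceptional .
  interpret bowditch_bound n \<Delta> v0 \<phi> K using K by unfold_locales
  obtain c where c: "c > 0"
    "\<And>w i j. word w \<Longrightarrow> i \<in> {1..n} \<Longrightarrow> j \<in> {1..n} \<Longrightarrow> i \<noteq> j \<Longrightarrow> fib_bound c w i j"
    using fib_bound_all by blast
  have "log_plus (norm (hurwitz_ext n \<Delta> \<phi> \<gamma>)) \<ge> c * real (fibonacci n \<Delta> v0 \<gamma>)"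
    if \<gamma>: "\<gamma> \<in> alt_geodesics n \<Delta>" and gt: "norm (hurwitz_ext n \<Delta> \<phi> \<gamma>) > K" for \<gamma>
  proof -
    obtain w i j where w: "word w" "i \<in> {1..n}" "j \<in> {1..n}" "i \<noteq> j" and "\<gamma> = component \<Delta> (V w) {i, j}"
      using alt_geodesicE[OF \<gamma>] .
    then have eq: "hurwitz_ext n \<Delta> \<phi> \<gamma> = P w {i, j}" "fibonacci n \<Delta> v0 \<gamma> = fib_word w i j"
      using hurwitz_ext_V[OF w] fibonacci_V[OF w] by simp_all
    have "c * real (fib_word w i j) \<le> ln (norm (P w {i, j}) / 2)"
      using c(2)[OF w] gt eq(1) by (simp add: fib_bound_def)
    also have "\<dots> \<le> ln (norm (P w {i, j}))"
      using gt K(1) eq(1) by (intro ln_mono) auto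
    also have "\<dots> \<le> log_plus (norm (P w {i, j}))" by (simp add: log_plus_def)
    finally show ?thesis by (simp only: eq)
  qed
  \<comment> \<open>The definition of the bound divides by its constant, so the witness is
    \<open>1 / c\<close>; every exception has norm at most \<open>K\<close>.\<close>
  then have "{\<gamma> \<in> alt_geodesics n \<Delta>. \<not> log_plus (norm (hurwitz_ext n \<Delta> \<phi> \<gamma>)) \<ge>
      1 / (1 / c) * real (fibonacci n \<Delta> v0 \<gamma>)} \<subseteq>
      {\<gamma> \<in> alt_geodesics n \<Delta>. norm (hurwitz_ext n \<Delta> \<phi> \<gamma>) \<le> K}"
    by (auto simp: not_le[symmetric])
  then have "finite {\<gamma> \<in> alt_geodesics n \<Delta>. \<not> log_plus (norm (hurwitz_ext n \<Delta> \<phi> \<gamma>)) \<ge>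
      1 / (1 / c) * real (fibonacci n \<Delta> v0 \<gamma>)}"
    using K(3) finite_subset by blast
  moreover have "1 / c > 0" using c(1) by simp
  ultimately show ?thesis unfolding lower_fibonacci_bound_def by blast
qed

end
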